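(* There exists a two-way entanglement purification protocol (2-EPP) which produces at least $1$ good EPR pair from $9$ EPR pairs when there are up to $2$ errors. In particular, 2-EPPs can exceed the quantum Hamming bound $2^k\sum_{j=0}^{t}3^j\binom{n}{j}\le 2^n$: this inequality fails for $n=9$, $k=1$, $t=2$.
   Context: An EPR pair is a two-qubit state $\frac{1}{\sqrt2}(|00\rangle+|11\rangle)$, with the first qubit held by Alice and the second by Bob. In an entanglement purification protocol on $n$ pairs, Alice prepares $n$ EPR pairs and sends the second half of each to Bob through a noisy quantum channel, which acts on the $n$ transmitted qubits. Alice and Bob then process their qubits by local quantum operations (including measurements) and communication over noiseless classical channels. The protocol is a two-way protocol (2-EPP) if classical communication is allowed in both directions, so that each local operation may depend on all measurement results communicated so far. At the end the parties output pairs of qubits (one qubit of each pair with Alice, one with Bob). A 2-EPP produces at least $k$ good EPR pairs from $n$ pairs with up to $t$ errors if, for every channel of the form $\mathcal{S}\otimes I$, where $\mathcal{S}$ is an arbitrary superoperator (quantum channel) acting on some set of at most $t$ of the $n$ transmitted qubits (the set being unknown to Alice and Bob) and $I$ is the identity on the remaining transmitted qubits, the protocol always (with probability 1) outputs at least $k$ pairs that are exactly (fidelity 1) in the state of perfect EPR pairs. The protocol may not depend on the set of affected qubits or on $\mathcal{S}$. *)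

theory Defs
  imports Complex_Main "HOL-Library.Nonpos_Ints"
begin

datatype party = Alice | Bob

type_synonym qubit = "party \<times> nat"

text \<open>
  The computational basis of a finite register \<open>Q\<close> of qubits is indexed by the subsets of \<open>Q\<close>:
  the basis state \<open>X \<subseteq> Q\<close> is the one in which exactly the qubits in \<open>X\<close> have value 1. An operator
  is given by its matrix in this basis; entries at indices outside \<open>Pow Q\<close> are never inspected.
  A superoperator \<open>S\<close> from \<open>Q\<close> to \<open>Q'\<close> is given by its matrix as well: \<open>S Z W X Y\<close> is the
  coefficient of \<open>|Z><W|\<close> in the image of \<open>|X><Y|\<close>.
\<close>

type_synonym operator = "qubit set \<Rightarrow> qubit set \<Rightarrow> complex"

type_synonym superop = "qubit set \<Rightarrow> qubit set \<Rightarrow> operator"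

definition trace :: "qubit set \<Rightarrow> operator \<Rightarrow> complex" where
  "trace Q \<rho> = (\<Sum>X\<in>Pow Q. \<rho> X X)"

definition psd :: "qubit set \<Rightarrow> operator \<Rightarrow> bool" where
  "psd Q \<rho> \<longleftrightarrow>
    (\<forall>v :: qubit set \<Rightarrow> complex.
      (\<Sum>X\<in>Pow Q. \<Sum>Y\<in>Pow Q. cnj (v X) * \<rho> X Y * v Y) \<in> \<real>\<^sub>\<ge>\<^sub>0)"

text \<open>
  \<open>act Q Q' E S \<rho>\<close> is \<open>(S \<otimes> I)(\<rho>)\<close>, where \<open>S\<close> maps the register \<open>Q\<close> to the register \<open>Q'\<close>
  and \<open>I\<close> is the identity on a register \<open>E\<close> disjoint from both.
\<close>

definition act :: "qubit set \<Rightarrow> qubit set \<Rightarrow> qubit set \<Rightarrow> superop \<Rightarrow> operator \<Rightarrow> operator" where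
  "act Q Q' E S \<rho> Z W =
    (\<Sum>X\<in>Pow Q. \<Sum>Y\<in>Pow Q.
      S (Z \<inter> Q') (W \<inter> Q') X Y * \<rho> (X \<union> (Z \<inter> E)) (Y \<union> (W \<inter> E)))"

definition completely_positive :: "qubit set \<Rightarrow> qubit set \<Rightarrow> superop \<Rightarrow> bool" where
  "completely_positive Q Q' S \<longleftrightarrow>
    (\<forall>E \<rho>. finite E \<and> E \<inter> (Q \<union> Q') = {} \<and> psd (Q \<union> E) \<rho>
      \<longrightarrow> psd (Q' \<union> E) (act Q Q' E S \<rho>))"

text \<open>
  A quantum instrument: outcome \<open>(Q', S)\<close> turns the state \<open>\<rho>\<close> of \<open>Q\<close> into the unnormalised state
  \<open>S(\<rho>)\<close> of \<open>Q'\<close>, whose trace is the probability of that outcome. The output register may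
  depend on the outcome, so that ancillas can be introduced and qubits discarded.
\<close>

definition instrument :: "qubit set \<Rightarrow> (qubit set \<times> superop) list \<Rightarrow> bool" where
  "instrument Q os \<longleftrightarrow>
    (\<forall>(Q', S)\<in>set os. finite Q' \<and> completely_positive Q Q' S) \<and>
    (\<forall>\<rho>. (\<Sum>(Q', S)\<leftarrow>os. trace Q' (act Q Q' {} S \<rho>)) = trace Q \<rho>)"

definition channel :: "qubit set \<Rightarrow> qubit set \<Rightarrow> superop \<Rightarrow> bool" where
  "channel Q Q' S \<longleftrightarrow>
    finite Q' \<and> completely_positive Q Q' S \<and>
    (\<forall>\<rho>. trace Q' (act Q Q' {} S \<rho>) = trace Q \<rho>)"

text \<open>
  In \<open>Operate p bs\<close> party \<open>p\<close> applies an instrument to all of its qubits and announces the outcome.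
  Each entry \<open>(M, S, P)\<close> of \<open>bs\<close> is an outcome: \<open>S\<close> is the operation, \<open>M\<close> labels the qubits that \<open>p\<close>
  holds afterwards, and \<open>P\<close> is the rest of the protocol, which may thus depend on all outcomes
  announced so far by both parties. Results that are not announced stay in the local register.
\<close>

datatype protocol =
    Output
  | Operate party "(nat set \<times> superop \<times> protocol) list"

text \<open>\<open>R p\<close> is the set of labels of the qubits currently held by party \<open>p\<close>.\<close>

type_synonym registers = "party \<Rightarrow> nat set"

definition held :: "party \<Rightarrow> registers \<Rightarrow> qubit set" where
  "held p R = {p} \<times> R p"

definition held_by_other :: "party \<Rightarrow> registers \<Rightarrow> qubit set" where
  "held_by_other p R = Sigma (- {p}) R"

definition all_qubits :: "registers \<Rightarrow> qubit set" where
  "all_qubits R = Sigma UNIV R"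

text \<open>
  At the end Alice and Bob hold qubits with the same labels; the output pairs are
  \<open>(Alice, i)\<close>, \<open>(Bob, i)\<close> for these labels \<open>i\<close>.
\<close>

fun valid_protocol :: "protocol \<Rightarrow> registers \<Rightarrow> bool" where
  "valid_protocol Output R \<longleftrightarrow> R Alice = R Bob"
| "valid_protocol (Operate p bs) R \<longleftrightarrow>
    instrument (held p R) (map (\<lambda>(M, S, P). ({p} \<times> M, S)) bs) \<and>
    (\<forall>(M, S, P)\<in>set bs. valid_protocol P (R(p := M)))"

text \<open>
  The final registers and unnormalised final states of all branches of a protocol;
  the probability of a branch is the trace of its state.
\<close>

fun branches :: "protocol \<Rightarrow> registers \<Rightarrow> operator \<Rightarrow> (registers \<times> operator) set" where
  "branches Output R \<rho> = {(R, \<rho>)}"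
| "branches (Operate p bs) R \<rho> =
    (\<Union>(M, S, P)\<in>set bs.
      branches P (R(p := M)) (act (held p R) ({p} \<times> M) (held_by_other p R) S \<rho>))"

definition epr_amplitude :: "nat set \<Rightarrow> qubit set \<Rightarrow> complex" where
  "epr_amplitude M X =
    (\<Prod>i\<in>M. if (Alice, i) \<in> X \<longleftrightarrow> (Bob, i) \<in> X then 1 / complex_of_real (sqrt 2) else 0)"

definition epr_pairs :: "nat set \<Rightarrow> operator" where
  "epr_pairs M X Y = epr_amplitude M X * cnj (epr_amplitude M Y)"

definition initial_registers :: "nat \<Rightarrow> registers" where
  "initial_registers n = (\<lambda>p. {..<n})"

definition two_way_epp :: "nat \<Rightarrow> protocol \<Rightarrow> bool" where
  "two_way_epp n P \<longleftrightarrow> valid_protocol P (initial_registers n)"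

text \<open>The state shared after \<open>S \<otimes> I\<close>, with \<open>S\<close> acting on Bob's halves of the pairs in \<open>T\<close>.\<close>

definition noisy_pairs :: "nat \<Rightarrow> nat set \<Rightarrow> superop \<Rightarrow> operator" where
  "noisy_pairs n T S =
    act ({Bob} \<times> T) ({Bob} \<times> T) (all_qubits (initial_registers n) - {Bob} \<times> T) S
      (epr_pairs {..<n})"

text \<open>
  In every branch of nonzero probability there are at least \<open>k\<close> output pairs, and
  the normalised joint state of all output pairs is a tensor product of perfect EPR pairs.
\<close>

definition produces_good_pairs :: "protocol \<Rightarrow> nat \<Rightarrow> nat \<Rightarrow> nat \<Rightarrow> bool" where
  "produces_good_pairs P n k t \<longleftrightarrow>
    (\<forall>T S. T \<subseteq> {..<n} \<and> card T \<le> t \<and> channel ({Bob} \<times> T) ({Bob} \<times> T) S \<longrightarrow>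
      (\<forall>(R, \<sigma>)\<in>branches P (initial_registers n) (noisy_pairs n T S).
        trace (all_qubits R) \<sigma> \<noteq> 0 \<longrightarrow>
          k \<le> card (R Alice) \<and>
          (\<forall>X\<in>Pow (all_qubits R). \<forall>Y\<in>Pow (all_qubits R).
            \<sigma> X Y / trace (all_qubits R) \<sigma> = epr_pairs (R Alice) X Y)))"

definition quantum_hamming_bound :: "nat \<Rightarrow> nat \<Rightarrow> nat \<Rightarrow> bool" where
  "quantum_hamming_bound n k t \<longleftrightarrow> 2 ^ k * (\<Sum>j=0..t. 3 ^ j * (n choose j)) \<le> 2 ^ n"

end

theory Submission
  imports Defs
begin

text \<open>
  Split the nine pairs into a block of five, protected by the \<open>[[5,1,3]]\<close> graph code of the
  5-cycle, and a block of four, protected by the \<open>[[4,1,2]]\<close> graph code of the 4-cycle. Alice and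
  Bob compare their syndromes. The first code detects two errors, so if its syndrome is trivial
  its encoded pair is perfect. Otherwise the second block has at most one error, which its code
  detects, so if the second syndrome is trivial then the second encoded pair is perfect.
  Otherwise each block has exactly one error, and the first code corrects it.

  Only linearity of the noise in its matrix is used: every branch is a linear map on vectors that
  sends each vector \<open>(N \<otimes> I)|EPR>\<close>, with \<open>N\<close> a matrix unit on at most two of Bob's
  qubits, to a multiple of the output EPR vector.
\<close>

section \<open>Local operations on vectors\<close>

type_synonym local_operator = "nat set \<Rightarrow> nat set \<Rightarrow> complex"

type_synonym vec = "registers \<Rightarrow> complex"

text \<open>The map with the single Kraus operator \<open>k\<close> on the register of
  \<open>p\<close>; taking the image of \<open>{p}\<close> strips the party from the labels.\<close>

definition lift :: "party \<Rightarrow> local_operator \<Rightarrow> superop" where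
  "lift p k Z W X Y = k (Z `` {p}) (X `` {p}) * cnj (k (W `` {p}) (Y `` {p}))"

definition labels :: "qubit set \<Rightarrow> registers" where
  "labels X = (\<lambda>p. X `` {p})"

definition apply_local :: "party \<Rightarrow> nat set \<Rightarrow> local_operator \<Rightarrow> vec \<Rightarrow> vec" where
  "apply_local p Q k \<psi> s = (\<Sum>x\<in>Pow Q. k (s p) x * \<psi> (s(p := x)))"

text \<open>\<open>\<rho>\<close> as a complex combination of the terms |f j><g j|. Kets and bras
  may differ, so the matrix of a superoperator fits directly.\<close>

definition mixture ::
  "'j set \<Rightarrow> ('j \<Rightarrow> complex) \<Rightarrow> ('j \<Rightarrow> vec) \<Rightarrow> ('j \<Rightarrow> vec) \<Rightarrow> registers \<Rightarrow> operator \<Rightarrow> bool" where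
  "mixture J c f g R \<rho> \<longleftrightarrow>
    (\<forall>X\<in>Pow (all_qubits R). \<forall>Y\<in>Pow (all_qubits R).
      \<rho> X Y = (\<Sum>j\<in>J. c j * f j (labels X) * cnj (g j (labels Y))))"

definition complete_kraus :: "nat set \<Rightarrow> (nat set \<times> local_operator) list \<Rightarrow> bool" where
  "complete_kraus Q ks \<longleftrightarrow>
    (\<forall>x\<in>Pow Q. \<forall>y\<in>Pow Q.
      (\<Sum>(M, k)\<leftarrow>ks. \<Sum>z\<in>Pow M. k z x * cnj (k z y)) = (if x = y then 1 else 0))"

section \<open>Kraus operators and instruments\<close>

lemma sum_Pow_Un:
  assumes "A \<inter> B = {}"
  shows "(\<Sum>X\<in>Pow (A \<union> B). f X) = (\<Sum>X\<in>Pow A. \<Sum>Y\<in>Pow B. f (X \<union> Y))"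
  unfolding sum.cartesian_product
  by (rule sum.reindex_bij_witness[where i = "\<lambda>(X, Y). X \<union> Y" and j = "\<lambda>X. (X \<inter> A, X \<inter> B)"])
    (use assms in \<open>auto simp: inf.absorb1 simp flip: Int_Un_distrib\<close>)

lemma Pow_Times: "Pow ({p} \<times> M) = (\<lambda>x. {p} \<times> x) ` Pow M"
proof
  show "Pow ({p} \<times> M) \<subseteq> (\<lambda>x. {p} \<times> x) ` Pow M"
  proof
    fix X assume "X \<in> Pow ({p} \<times> M)"
    then have "X = {p} \<times> (X `` {p})" "X `` {p} \<in> Pow M" by auto
    then show "X \<in> (\<lambda>x. {p} \<times> x) ` Pow M" by blast
  qed
qed auto

lemma sum_Pow_Times: "(\<Sum>X\<in>Pow ({p} \<times> M). f X) = (\<Sum>x\<in>Pow M. f ({p} \<times> x))"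
  unfolding Pow_Times by (subst sum.reindex) (auto simp: inj_on_def)

text \<open>The quadratic form of the image at \<open>v\<close> is that of \<open>\<rho>\<close> at
  \<open>u\<close>, the image of \<open>v\<close> under the adjoint of \<open>K\<close> tensored
  with the identity.\<close>

lemma psd_kraus:
  assumes Q: "finite Q" "finite Q'" and E: "finite E" "E \<inter> (Q \<union> Q') = {}"
    and \<rho>: "psd (Q \<union> E) \<rho>"
  shows "psd (Q' \<union> E) (act Q Q' E (\<lambda>Z W X Y. K Z X * cnj (K W Y)) \<rho>)"
  unfolding psd_def
proof
  fix v :: "qubit set \<Rightarrow> complex"
  define u where "u X = (\<Sum>z\<in>Pow Q'. cnj (K z (X \<inter> Q)) * v (z \<union> (X \<inter> E)))" for X
  have disj: "Q' \<inter> E = {}" "Q \<inter> E = {}" using E by auto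
  have i1: "(z \<union> e) \<inter> Q' = z" "(z \<union> e) \<inter> E = e" if "z \<in> Pow Q'" "e \<in> Pow E" for z e
    using that disj by auto
  have i2: "(z \<union> e) \<inter> Q = z" "(z \<union> e) \<inter> E = e" if "z \<in> Pow Q" "e \<in> Pow E" for z e
    using that disj by auto
  let ?t = "\<lambda>z e w e' X Y. cnj (v (z \<union> e)) * K z X * cnj (K w Y) * \<rho> (X \<union> e) (Y \<union> e') * v (w \<union> e')"
  have "(\<Sum>X\<in>Pow (Q' \<union> E). \<Sum>Y\<in>Pow (Q' \<union> E). cnj (v X) *
      act Q Q' E (\<lambda>Z W X Y. K Z X * cnj (K W Y)) \<rho> X Y * v Y)
    = (\<Sum>z\<in>Pow Q'. \<Sum>e\<in>Pow E. \<Sum>w\<in>Pow Q'. \<Sum>e'\<in>Pow E. \<Sum>X\<in>Pow Q. \<Sum>Y\<in>Pow Q. ?t z e w e' X Y)"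
    unfolding sum_Pow_Un[OF disj(1)] act_def
    by (intro sum.cong refl) (simp only: i1, simp add: sum_distrib_left sum_distrib_right mult.assoc)
  also have "\<dots> = (\<Sum>(z, e, w, e', X, Y)\<in>Pow Q' \<times> Pow E \<times> Pow Q' \<times> Pow E \<times> Pow Q \<times> Pow Q. ?t z e w e' X Y)"
    by (simp only: sum.cartesian_product case_prod_unfold fst_conv snd_conv)
  \<comment> \<open>With the row and column indices of \<open>\<rho>\<close> in front, the inner
    sums over \<open>z\<close> and \<open>w\<close> form \<open>cnj (u X)\<close> and
    \<open>u Y\<close>.\<close>
  also have "\<dots> = (\<Sum>(X, e, Y, e', z, w)\<in>Pow Q \<times> Pow E \<times> Pow Q \<times> Pow E \<times> Pow Q' \<times> Pow Q'. ?t z e w e' X Y)"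
    by (rule sum.reindex_bij_witness[where i = "\<lambda>(X, e, Y, e', z, w). (z, e, w, e', X, Y)"
          and j = "\<lambda>(z, e, w, e', X, Y). (X, e, Y, e', z, w)"]) auto
  also have "\<dots> = (\<Sum>X\<in>Pow Q. \<Sum>e\<in>Pow E. \<Sum>Y\<in>Pow Q. \<Sum>e'\<in>Pow E. \<Sum>z\<in>Pow Q'. \<Sum>w\<in>Pow Q'. ?t z e w e' X Y)"
    by (simp only: sum.cartesian_product case_prod_unfold fst_conv snd_conv)
  also have "\<dots> = (\<Sum>X\<in>Pow (Q \<union> E). \<Sum>Y\<in>Pow (Q \<union> E). cnj (u X) * \<rho> X Y * u Y)"
    unfolding sum_Pow_Un[OF disj(2)] u_def
    by (intro sum.cong refl)
      (simp only: i2, simp add: sum_distrib_left sum_distrib_right cnj_sum mult_ac)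
  also have "\<dots> \<in> \<real>\<^sub>\<ge>\<^sub>0"
    using \<rho> unfolding psd_def by blast
  finally show "(\<Sum>X\<in>Pow (Q' \<union> E). \<Sum>Y\<in>Pow (Q' \<union> E). cnj (v X) *
      act Q Q' E (\<lambda>Z W X Y. K Z X * cnj (K W Y)) \<rho> X Y * v Y) \<in> \<real>\<^sub>\<ge>\<^sub>0" .
qed

lemma completely_positive_lift:
  assumes "finite Q" "finite M"
  shows "completely_positive ({p} \<times> Q) ({p} \<times> M) (lift p k)"
  unfolding completely_positive_def lift_def
  using assms by (auto intro!: psd_kraus[where K = "\<lambda>Z X. k (Z `` {p}) (X `` {p})"])

text \<open>By cyclicity of the trace each outcome contributes the trace of \<open>\<rho>\<close>
  against the adjoint of its Kraus operator times that operator; \<open>complete_kraus\<close> says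
  that these products sum to the identity.\<close>

lemma instrument_lift:
  assumes Q: "finite Q" and ks: "complete_kraus Q ks" and M: "\<forall>(M, k)\<in>set ks. finite M"
  shows "instrument ({p} \<times> Q) (map (\<lambda>(M, k). ({p} \<times> M, lift p k)) ks)"
  unfolding instrument_def
proof (intro conjI allI)
  show "\<forall>(Q', S)\<in>set (map (\<lambda>(M, k). ({p} \<times> M, lift p k)) ks).
      finite Q' \<and> completely_positive ({p} \<times> Q) Q' S"
    using M Q by (auto intro: completely_positive_lift)
next
  fix \<rho> :: operator
  have im: "({p} \<times> x) `` {p} = x" for x by auto
  have int: "({p} \<times> z) \<inter> ({p} \<times> M) = {p} \<times> z" if "z \<in> Pow M" for z M
    using that by auto
  let ?r = "\<lambda>x y. \<rho> ({p} \<times> x) ({p} \<times> y)"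
  have tr: "trace ({p} \<times> M) (act ({p} \<times> Q) ({p} \<times> M) {} (lift p k) \<rho>)
      = (\<Sum>x\<in>Pow Q. \<Sum>y\<in>Pow Q. ?r x y * (\<Sum>z\<in>Pow M. k z x * cnj (k z y)))" for M k
  proof -
    have "trace ({p} \<times> M) (act ({p} \<times> Q) ({p} \<times> M) {} (lift p k) \<rho>)
      = (\<Sum>z\<in>Pow M. \<Sum>x\<in>Pow Q. \<Sum>y\<in>Pow Q. k z x * cnj (k z y) * ?r x y)"
      unfolding trace_def act_def lift_def sum_Pow_Times
      by (intro sum.cong refl) (simp only: int im, simp)
    also have "\<dots> = (\<Sum>x\<in>Pow Q. \<Sum>z\<in>Pow M. \<Sum>y\<in>Pow Q. k z x * cnj (k z y) * ?r x y)"
      by (rule sum.swap)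
    also have "\<dots> = (\<Sum>x\<in>Pow Q. \<Sum>y\<in>Pow Q. \<Sum>z\<in>Pow M. k z x * cnj (k z y) * ?r x y)"
      by (rule sum.cong[OF refl]) (rule sum.swap)
    finally show ?thesis by (simp add: sum_distrib_left sum_distrib_right mult_ac)
  qed
  have "(\<Sum>(M, k)\<leftarrow>ks. \<Sum>x\<in>Pow Q. \<Sum>y\<in>Pow Q. ?r x y * (\<Sum>z\<in>Pow M. k z x * cnj (k z y)))
      = (\<Sum>x\<in>Pow Q. \<Sum>y\<in>Pow Q. ?r x y * (\<Sum>(M, k)\<leftarrow>ks. \<Sum>z\<in>Pow M. k z x * cnj (k z y)))"
    by (induction ks) (auto simp: sum.distrib ring_distribs)
  also have "\<dots> = (\<Sum>x\<in>Pow Q. \<Sum>y\<in>Pow Q. if x = y then ?r x y else 0)"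
    using ks unfolding complete_kraus_def by (intro sum.cong refl) auto
  also have "\<dots> = (\<Sum>x\<in>Pow Q. ?r x x)"
    using Q by (intro sum.cong refl) (simp add: sum.delta)
  finally show "(\<Sum>(Q', S)\<leftarrow>map (\<lambda>(M, k). ({p} \<times> M, lift p k)) ks. trace Q' (act ({p} \<times> Q) Q' {} S \<rho>))
      = trace ({p} \<times> Q) \<rho>"
    by (simp add: case_prod_unfold o_def tr trace_def[of "{p} \<times> Q" \<rho>] sum_Pow_Times)
qed

text \<open>A Kraus operator turns |f><g| into |kf><kg|, so the coefficients stay and following a
  branch reduces to following vectors.\<close>

lemma mixture_act:
  assumes mix: "mixture J c f g R \<rho>"
  shows "mixture J c (\<lambda>j. apply_local p (R p) k (f j)) (\<lambda>j. apply_local p (R p) k (g j)) (R(p := M))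
    (act (held p R) ({p} \<times> M) (held_by_other p R) (lift p k) \<rho>)"
  unfolding mixture_def
proof (intro ballI)
  fix Z W assume Z: "Z \<in> Pow (all_qubits (R(p := M)))" and W: "W \<in> Pow (all_qubits (R(p := M)))"
  have im: "({p} \<times> x) `` {p} = x" for x by auto
  have int: "(U \<inter> ({p} \<times> M)) `` {p} = labels U p" if "U \<in> Pow (all_qubits (R(p := M)))" for U
    using that by (auto simp: all_qubits_def labels_def)
  have lab: "labels ({p} \<times> x \<union> (U \<inter> held_by_other p R)) = (labels U)(p := x)"
    and sub: "{p} \<times> x \<union> (U \<inter> held_by_other p R) \<in> Pow (all_qubits R)"
    if "U \<in> Pow (all_qubits (R(p := M)))" "x \<in> Pow (R p)" for U x
    using that by (auto simp: all_qubits_def labels_def held_by_other_def fun_eq_iff split: if_splits)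
  have "act (held p R) ({p} \<times> M) (held_by_other p R) (lift p k) \<rho> Z W
    = (\<Sum>x\<in>Pow (R p). \<Sum>y\<in>Pow (R p). k (labels Z p) x * cnj (k (labels W p) y) *
        (\<Sum>j\<in>J. c j * f j ((labels Z)(p := x)) * cnj (g j ((labels W)(p := y)))))"
    unfolding act_def held_def lift_def sum_Pow_Times
    apply (intro sum.cong refl)
    subgoal for x y
      using mix[unfolded mixture_def, rule_format, OF sub[OF Z, of x] sub[OF W, of y]]
      by (simp only: int[OF Z] int[OF W] im lab[OF Z] lab[OF W])
    done
  also have "\<dots> = (\<Sum>x\<in>Pow (R p). \<Sum>j\<in>J. \<Sum>y\<in>Pow (R p). k (labels Z p) x * cnj (k (labels W p) y) *
        (c j * f j ((labels Z)(p := x)) * cnj (g j ((labels W)(p := y)))))"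
    unfolding sum_distrib_left by (intro sum.cong refl) (rule sum.swap)
  also have "\<dots> = (\<Sum>j\<in>J. \<Sum>x\<in>Pow (R p). \<Sum>y\<in>Pow (R p). k (labels Z p) x * cnj (k (labels W p) y) *
        (c j * f j ((labels Z)(p := x)) * cnj (g j ((labels W)(p := y)))))"
    by (rule sum.swap)
  also have "\<dots> = (\<Sum>j\<in>J. c j * apply_local p (R p) k (f j) (labels Z) *
      cnj (apply_local p (R p) k (g j) (labels W)))"
    unfolding apply_local_def cnj_sum
    by (intro sum.cong refl) (simp add: sum_distrib_left sum_distrib_right mult_ac)
  finally show "act (held p R) ({p} \<times> M) (held_by_other p R) (lift p k) \<rho> Z W = \<dots>" .
qed

text \<open>Bob's qubits in \<open>T\<close> undergo the matrix unit \<open>|z><x|\<close>; these span all operators on \<open>T\<close>.\<close>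

definition unit_error :: "nat set \<Rightarrow> nat set \<Rightarrow> nat set \<Rightarrow> vec \<Rightarrow> vec" where
  "unit_error T z x \<psi> s = (if s Bob \<inter> T = z then \<psi> (s(Bob := x \<union> (s Bob - T))) else 0)"

definition epr_vec :: "nat set \<Rightarrow> vec" where
  "epr_vec M s = (if s Alice = s Bob then (1 / complex_of_real (sqrt 2)) ^ card M else 0)"

lemma epr_amplitude_eq:
  assumes M: "finite M" and R: "R Alice = M" "R Bob = M" and X: "X \<subseteq> all_qubits R"
  shows "epr_amplitude M X = epr_vec M (labels X)"
proof (cases "labels X Alice = labels X Bob")
  case True
  then have "(Alice, i) \<in> X \<longleftrightarrow> (Bob, i) \<in> X" for i
    by (auto simp: labels_def)
  with True show ?thesis by (simp add: epr_amplitude_def epr_vec_def)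
next
  case False
  then obtain i where i: "(Alice, i) \<in> X \<longleftrightarrow> (Bob, i) \<notin> X"
    by (auto simp: labels_def)
  with X R have "i \<in> M" by (auto simp: all_qubits_def)
  with False i M show ?thesis
    by (auto simp: epr_amplitude_def epr_vec_def prod_zero_iff)
qed

text \<open>The matrix entries of \<open>S\<close> write the noise as a combination of the maps that
  multiply by |z><x| on the left and by |y><w| on the right.\<close>

lemma mixture_noisy_pairs:
  assumes T: "T \<subseteq> {..<n}"
  shows "mixture (Pow T \<times> Pow T \<times> Pow T \<times> Pow T)
    (\<lambda>(z, w, x, y). S ({Bob} \<times> z) ({Bob} \<times> w) ({Bob} \<times> x) ({Bob} \<times> y))
    (\<lambda>(z, w, x, y). unit_error T z x (epr_vec {..<n})) (\<lambda>(z, w, x, y). unit_error T w y (epr_vec {..<n}))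
    (initial_registers n) (noisy_pairs n T S)"
  unfolding mixture_def
proof (intro ballI)
  let ?R = "initial_registers n"
  let ?e = "epr_vec {..<n}"
  fix Z W assume Z: "Z \<in> Pow (all_qubits ?R)" and W: "W \<in> Pow (all_qubits ?R)"
  have fin: "finite (Pow T)" using T finite_subset by auto
  have int: "U \<inter> ({Bob} \<times> T) = {Bob} \<times> (labels U Bob \<inter> T)" for U :: "qubit set"
    by (auto simp: labels_def)
  have epr: "epr_amplitude {..<n} ({Bob} \<times> x \<union> (U \<inter> (all_qubits ?R - {Bob} \<times> T)))
      = ?e ((labels U)(Bob := x \<union> (labels U Bob - T)))"
    if "x \<in> Pow T" and U: "U \<in> Pow (all_qubits ?R)" for x U
  proof -
    have "{Bob} \<times> x \<union> (U \<inter> (all_qubits ?R - {Bob} \<times> T)) \<subseteq> all_qubits ?R"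
      using that T by (auto simp: all_qubits_def initial_registers_def)
    then have "epr_amplitude {..<n} ({Bob} \<times> x \<union> (U \<inter> (all_qubits ?R - {Bob} \<times> T)))
        = ?e (labels ({Bob} \<times> x \<union> (U \<inter> (all_qubits ?R - {Bob} \<times> T))))"
      by (intro epr_amplitude_eq[where R = ?R]) (auto simp: initial_registers_def)
    also have "labels ({Bob} \<times> x \<union> (U \<inter> (all_qubits ?R - {Bob} \<times> T)))
        = (labels U)(Bob := x \<union> (labels U Bob - T))"
      using U by (auto simp: labels_def all_qubits_def fun_eq_iff)
    finally show ?thesis .
  qed
  let ?S = "\<lambda>z w x y. S ({Bob} \<times> z) ({Bob} \<times> w) ({Bob} \<times> x) ({Bob} \<times> y)"
  let ?z = "labels Z Bob \<inter> T" and ?w = "labels W Bob \<inter> T"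
  let ?f = "\<lambda>U x. ?e ((labels U)(Bob := x \<union> (labels U Bob - T)))"
  have "noisy_pairs n T S Z W = (\<Sum>x\<in>Pow T. \<Sum>y\<in>Pow T. ?S ?z ?w x y * (?f Z x * cnj (?f W y)))"
    unfolding noisy_pairs_def act_def epr_pairs_def sum_Pow_Times int
    by (intro sum.cong refl) (simp only: epr Z W)
  \<comment> \<open>The output indices are fixed by \<open>Z\<close> and \<open>W\<close>. Delta
    sums free them, and the deltas become the condition in \<open>unit_error\<close>.\<close>
  also have "\<dots> = (\<Sum>z\<in>Pow T. if z = ?z then
      (\<Sum>x\<in>Pow T. \<Sum>y\<in>Pow T. ?S z ?w x y * (?f Z x * cnj (?f W y))) else 0)"
    using fin by (subst sum.delta) auto
  also have "\<dots> = (\<Sum>z\<in>Pow T. if z = ?z then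
      (\<Sum>w\<in>Pow T. if w = ?w then \<Sum>x\<in>Pow T. \<Sum>y\<in>Pow T. ?S z w x y * (?f Z x * cnj (?f W y)) else 0) else 0)"
    using fin by (subst sum.delta) auto
  also have "\<dots> = (\<Sum>z\<in>Pow T. \<Sum>w\<in>Pow T. \<Sum>x\<in>Pow T. \<Sum>y\<in>Pow T.
      ?S z w x y * unit_error T z x ?e (labels Z) * cnj (unit_error T w y ?e (labels W)))"
    unfolding unit_error_def
    apply (intro sum.cong refl)
    subgoal for z
      by (cases "z = ?z") (auto intro!: sum.cong simp: mult.assoc)
    done
  finally show "noisy_pairs n T S Z W = (\<Sum>j\<in>Pow T \<times> Pow T \<times> Pow T \<times> Pow T.
      (case j of (z, w, x, y) \<Rightarrow> ?S z w x y) *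
      (case j of (z, w, x, y) \<Rightarrow> unit_error T z x ?e) (labels Z) *
      cnj ((case j of (z, w, x, y) \<Rightarrow> unit_error T w y ?e) (labels W)))"
    by (simp only: sum.cartesian_product case_prod_unfold fst_conv snd_conv)
qed

text \<open>Every term is a multiple of the same EPR projector, which has trace 1, so normalising
  \<open>\<sigma>\<close> gives exactly this projector.\<close>

lemma mixture_epr:
  assumes mix: "mixture J c f g R \<sigma>" and R: "R Alice = M" "R Bob = M" and M: "finite M"
    and f: "\<And>j s. j \<in> J \<Longrightarrow> s Alice \<subseteq> M \<Longrightarrow> s Bob \<subseteq> M \<Longrightarrow> f j s = \<alpha> j * epr_vec M s"
    and g: "\<And>j s. j \<in> J \<Longrightarrow> s Alice \<subseteq> M \<Longrightarrow> s Bob \<subseteq> M \<Longrightarrow> g j s = \<beta> j * epr_vec M s"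
    and tr: "trace (all_qubits R) \<sigma> \<noteq> 0"
    and XY: "X \<in> Pow (all_qubits R)" "Y \<in> Pow (all_qubits R)"
  shows "\<sigma> X Y / trace (all_qubits R) \<sigma> = epr_pairs M X Y"
proof -
  define \<gamma> where "\<gamma> = (\<Sum>j\<in>J. c j * \<alpha> j * cnj (\<beta> j))"
  have sub: "labels U Alice \<subseteq> M" "labels U Bob \<subseteq> M" if "U \<in> Pow (all_qubits R)" for U
    using that R by (auto simp: labels_def all_qubits_def)
  have amp: "epr_vec M (labels U) = epr_amplitude M U" if "U \<in> Pow (all_qubits R)" for U
    using that R M by (auto intro!: epr_amplitude_eq[symmetric])
  have \<sigma>: "\<sigma> U U' = \<gamma> * epr_pairs M U U'" if "U \<in> Pow (all_qubits R)" "U' \<in> Pow (all_qubits R)" for U U'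
  proof -
    have "\<sigma> U U' = (\<Sum>j\<in>J. c j * f j (labels U) * cnj (g j (labels U')))"
      using mix that by (auto simp: mixture_def)
    also have "\<dots> = (\<Sum>j\<in>J. c j * (\<alpha> j * epr_vec M (labels U)) * cnj (\<beta> j * epr_vec M (labels U')))"
      using f g sub that by (intro sum.cong refl) simp
    finally show ?thesis
      using that by (simp add: amp epr_pairs_def \<gamma>_def sum_distrib_left sum_distrib_right mult_ac)
  qed
  have UNIV_party: "(UNIV :: party set) = {Alice, Bob}"
    using party.exhaust by auto
  have fin: "finite (all_qubits R)"
    using R M by (auto simp: all_qubits_def UNIV_party)
  have qubits: "all_qubits R = {Alice} \<times> M \<union> {Bob} \<times> M"
    unfolding all_qubits_def UNIV_party using R by auto
  have "trace (all_qubits R) (epr_pairs M)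
      = (\<Sum>U\<in>Pow (all_qubits R). epr_vec M (labels U) * cnj (epr_vec M (labels U)))"
    unfolding trace_def epr_pairs_def by (intro sum.cong refl) (simp only: amp)
  also have "\<dots> = (\<Sum>a\<in>Pow M. \<Sum>b\<in>Pow M. if a = b then (1 / 2) ^ card M else 0)"
    unfolding qubits
    apply (subst sum_Pow_Un, force)
    unfolding sum_Pow_Times
    by (intro sum.cong refl)
      (auto simp: epr_vec_def labels_def Image_Un power_mult_distrib[symmetric] simp flip: of_real_mult)
  also have "\<dots> = 1"
    using M by (simp add: sum.delta card_Pow power_one_over)
  finally have "trace (all_qubits R) (epr_pairs M) = 1" .
  moreover have "trace (all_qubits R) \<sigma> = \<gamma> * trace (all_qubits R) (epr_pairs M)"
    unfolding trace_def sum_distrib_left by (intro sum.cong refl) (simp only: \<sigma>)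
  ultimately have "trace (all_qubits R) \<sigma> = \<gamma>" by simp
  with tr \<sigma>[OF XY] show ?thesis by simp
qed

section \<open>Graph states of a 5-cycle and a 4-cycle\<close>

text \<open>Addition of bit strings modulo 2, in a form that reduces to propositional logic on each
  bit.\<close>

definition sd :: "nat set \<Rightarrow> nat set \<Rightarrow> nat set" where
  "sd A B = {i. (i \<in> A) \<noteq> (i \<in> B)}"

lemma in_sd [simp]: "i \<in> sd A B \<longleftrightarrow> (i \<in> A) \<noteq> (i \<in> B)"
  by (simp add: sd_def)

definition sign :: "nat set \<Rightarrow> nat set \<Rightarrow> complex" where
  "sign c x = (\<Prod>i\<in>x. if i \<in> c then -1 else 1)"

definition nxt :: "nat \<Rightarrow> nat" where
  "nxt i = (if i = 4 then 0 else if i = 8 then 5 else i + 1)"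

definition prv :: "nat \<Rightarrow> nat" where
  "prv i = (if i = 0 then 4 else if i = 5 then 8 else i - 1)"

text \<open>One factor per edge \<open>{i, nxt i}\<close> of the two cycles: the signs of their
  joint graph state.\<close>

definition phase :: "nat set \<Rightarrow> complex" where
  "phase x = (\<Prod>i<9. if i \<in> x \<and> nxt i \<in> x then -1 else 1)"

text \<open>The adjacency matrix of the two cycles applied to \<open>x\<close> modulo 2.\<close>

definition nbrs :: "nat set \<Rightarrow> nat set" where
  "nbrs x = {i. i < 9 \<and> (prv i \<in> x) \<noteq> (nxt i \<in> x)}"

text \<open>The unnormalised amplitude at \<open>x\<close> of the graph basis state
  \<open>c\<close>, the graph state with Z applied at the vertices in \<open>c\<close>.\<close>

definition row :: "nat set \<Rightarrow> nat set \<Rightarrow> complex" where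
  "row c x = phase x * sign c x"

section \<open>Characters and the quadratic phase\<close>

lemma sign_eq_power: "finite x \<Longrightarrow> sign c x = (-1) ^ card (c \<inter> x)"
proof (induction x rule: finite_induct)
  case (insert i x)
  then show ?case by (auto simp: sign_def Int_insert_right)
qed (simp add: sign_def)

lemma sign_commute: "finite c \<Longrightarrow> finite x \<Longrightarrow> sign c x = sign x c"
  by (simp add: sign_eq_power Int_commute)

lemma sign_sd: "sign (sd c d) x = sign c x * sign d x"
  unfolding sign_def prod.distrib[symmetric] by (intro prod.cong) auto

lemma sign_sd_right:
  assumes "finite x" "finite y" "finite c"
  shows "sign c (sd x y) = sign c x * sign c y"
proof -
  have "finite (sd x y)"
    by (rule finite_subset[of _ "x \<union> y"]) (use assms in auto)
  then show ?thesis
    using assms by (simp add: sign_commute[of c] sign_sd)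
qed

lemma sign_Un: "finite x \<Longrightarrow> finite y \<Longrightarrow> x \<inter> y = {} \<Longrightarrow> sign c (x \<union> y) = sign c x * sign c y"
  unfolding sign_def by (rule prod.union_disjoint)

lemma cnj_sign [simp]: "cnj (sign c x) = sign c x"
  unfolding sign_def cnj_prod by (intro prod.cong) auto

lemma phase_sq [simp]: "phase x * phase x = 1"
  unfolding phase_def prod.distrib[symmetric] by (intro prod.neutral) auto

lemma cnj_phase [simp]: "cnj (phase x) = phase x"
  unfolding phase_def cnj_prod by (intro prod.cong) auto

lemma sum_sign:
  assumes "finite W"
  shows "(\<Sum>x\<in>Pow W. sign c x) = (if c \<inter> W = {} then 2 ^ card W else 0)"
proof -
  have "(\<Sum>x\<in>Pow W. sign c x) = (\<Prod>i\<in>W. (if i \<in> c then -1 else 1) + 1)"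
    using assms by (subst prod_add) (auto simp: sign_def)
  also have "\<dots> = (if c \<inter> W = {} then 2 ^ card W else 0)"
  proof (cases "c \<inter> W = {}")
    case True
    then have "(\<Prod>i\<in>W. (if i \<in> c then -1 else 1) + 1) = (\<Prod>i\<in>W. 2 :: complex)"
      by (intro prod.cong) auto
    with True show ?thesis by simp
  next
    case False
    with assms show ?thesis by (auto simp: prod_zero_iff)
  qed
  finally show ?thesis .
qed

text \<open>The exponent of \<open>phase\<close> is a quadratic form modulo 2. Its polar form counts
  the edges between \<open>x\<close> and \<open>v\<close>, which \<open>nbrs x\<close> records at
  their ends in \<open>v\<close>.\<close>

lemma phase_Un:
  assumes v: "v \<subseteq> {..<9}" and disj: "x \<inter> v = {}"
  shows "phase (x \<union> v) = phase x * phase v * sign (nbrs x) v"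
proof -
  let ?s = "\<lambda>b. if b then -1 else (1 :: complex)"
  have "phase (x \<union> v) = (\<Prod>i<9. ?s (i \<in> x \<and> nxt i \<in> x) * ?s (i \<in> v \<and> nxt i \<in> v) *
      ?s (i \<in> v \<and> nxt i \<in> x) * ?s (i \<in> x \<and> nxt i \<in> v))"
    unfolding phase_def using disj by (intro prod.cong) auto
  also have "\<dots> = phase x * phase v * (\<Prod>i<9. ?s (i \<in> v \<and> nxt i \<in> x)) *
      (\<Prod>i<9. ?s (i \<in> x \<and> nxt i \<in> v))"
    by (simp add: phase_def prod.distrib)
  \<comment> \<open>Edges directed from \<open>x\<close> to \<open>v\<close> are reindexed by their
    end in \<open>v\<close>, so that both directions meet at the same vertex.\<close>
  also have "(\<Prod>i<9. ?s (i \<in> x \<and> nxt i \<in> v)) = (\<Prod>i<9. ?s (prv i \<in> x \<and> i \<in> v))"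
    by (rule prod.reindex_bij_witness[where i = prv and j = nxt])
      (auto simp: prv_def nxt_def split: if_splits)
  also have "phase x * phase v * (\<Prod>i<9. ?s (i \<in> v \<and> nxt i \<in> x)) * (\<Prod>i<9. ?s (prv i \<in> x \<and> i \<in> v))
      = phase x * phase v * (\<Prod>i<9. ?s (i \<in> v \<and> i \<in> nbrs x))"
    unfolding mult.assoc prod.distrib[symmetric]
    by (intro arg_cong2[where f = "(*)"] refl prod.cong) (auto simp: nbrs_def)
  also have "(\<Prod>i<9. ?s (i \<in> v \<and> i \<in> nbrs x)) = sign (nbrs x) v"
    unfolding sign_def by (rule prod.mono_neutral_cong_right) (use v in auto)
  finally show ?thesis .
qed

lemma nbrs_sd: "nbrs (sd x y) = sd (nbrs x) (nbrs y)"
  by (auto simp: nbrs_def)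

text \<open>The matrix element of the error |z><x| between the graph basis states \<open>r\<close>
  and \<open>c\<close>. Off \<open>T\<close> the summand is a character of the free bits, so the sum
  vanishes unless the shift \<open>sd r c\<close> agrees there with
  \<open>nbrs (sd z x)\<close>.\<close>

lemma sum_row_row:
  assumes T: "T \<subseteq> {..<9}" and z: "z \<subseteq> T" and x: "x \<subseteq> T"
  shows "(\<Sum>y\<in>Pow {..<9}. if y \<inter> T = z then row r y * row c (x \<union> (y - T)) else 0)
    = (if sd (nbrs (sd z x)) (sd r c) \<inter> {..<9} \<subseteq> T
       then phase z * phase x * sign r z * sign c x * 2 ^ card ({..<9} - T) else 0)"
proof -
  let ?W = "{..<9} - T"
  let ?d = "sd (nbrs (sd z x)) (sd r c)"
  have fin: "finite T" "finite z" "finite x"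
    using T z x finite_subset[of _ "{..<9::nat}"] by blast+
  have "(\<Sum>y\<in>Pow {..<9}. if y \<inter> T = z then row r y * row c (x \<union> (y - T)) else 0)
      = (\<Sum>t\<in>Pow T. \<Sum>v\<in>Pow ?W. if (t \<union> v) \<inter> T = z then row r (t \<union> v) * row c (x \<union> (t \<union> v - T)) else 0)"
    using sum_Pow_Un[of T ?W] T by (simp add: Un_absorb1 Diff_partition)
  also have "\<dots> = (\<Sum>t\<in>Pow T. if t = z then \<Sum>v\<in>Pow ?W. row r (z \<union> v) * row c (x \<union> v) else 0)"
  proof (intro sum.cong refl)
    fix t assume "t \<in> Pow T"
    then have "(t \<union> v) \<inter> T = t" "t \<union> v - T = v" if "v \<in> Pow ?W" for v
      using that by auto
    then show "(\<Sum>v\<in>Pow ?W. if (t \<union> v) \<inter> T = z then row r (t \<union> v) * row c (x \<union> (t \<union> v - T)) else 0)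
        = (if t = z then \<Sum>v\<in>Pow ?W. row r (z \<union> v) * row c (x \<union> v) else 0)"
      by auto
  qed
  also have "\<dots> = (\<Sum>v\<in>Pow ?W. row r (z \<union> v) * row c (x \<union> v))"
    using z fin by (subst sum.delta) auto
  also have "\<dots> = (\<Sum>v\<in>Pow ?W. phase z * phase x * sign r z * sign c x * sign ?d v)"
  proof (intro sum.cong refl)
    fix v assume "v \<in> Pow ?W"
    then have v: "v \<subseteq> {..<9}" "finite v" "z \<inter> v = {}" "x \<inter> v = {}"
      using z x finite_subset[of v "{..<9}"] by auto
    \<comment> \<open>Both rows contain \<open>phase v\<close>, whose square is 1; only characters
      of \<open>v\<close> remain.\<close>
    have "row r (z \<union> v) * row c (x \<union> v)
        = phase z * phase x * sign r z * sign c x * (phase v * phase v) *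
          (sign (nbrs z) v * sign (nbrs x) v * (sign r v * sign c v))"
      using v fin by (simp add: row_def phase_Un sign_Un)
    then show "row r (z \<union> v) * row c (x \<union> v) = phase z * phase x * sign r z * sign c x * sign ?d v"
      by (simp add: sign_sd nbrs_sd)
  qed
  also have "\<dots> = phase z * phase x * sign r z * sign c x * (if ?d \<inter> ?W = {} then 2 ^ card ?W else 0)"
    by (simp add: sum_sign flip: sum_distrib_left)
  also have "?d \<inter> ?W = {} \<longleftrightarrow> ?d \<inter> {..<9} \<subseteq> T"
    by auto
  finally show ?thesis by simp
qed

lemma sum_row_cnj_row:
  assumes "x \<subseteq> {..<9}" "y \<subseteq> {..<9}"
  shows "(\<Sum>c\<in>Pow {..<9}. row c x * cnj (row c y)) = (if x = y then 512 else 0)"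
proof -
  have fin: "finite x" "finite y"
    using assms finite_subset[of _ "{..<9::nat}"] by blast+
  have "(\<Sum>c\<in>Pow {..<9}. row c x * cnj (row c y)) = (\<Sum>c\<in>Pow {..<9}. phase x * phase y * sign (sd x y) c)"
  proof (intro sum.cong refl)
    fix c :: "nat set" assume "c \<in> Pow {..<9}"
    then have "finite c" using finite_subset by auto
    then show "row c x * cnj (row c y) = phase x * phase y * sign (sd x y) c"
      using fin by (simp add: row_def sign_sd sign_commute[of _ c])
  qed
  also have "\<dots> = phase x * phase y * (if sd x y \<inter> {..<9} = {} then 512 else 0)"
    by (simp add: sum_sign flip: sum_distrib_left)
  also have "sd x y \<inter> {..<9} = {} \<longleftrightarrow> x = y"
    using assms by (auto simp: sd_def)
  finally show ?thesis by simp
qed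

section \<open>Error detection and correction in the two blocks\<close>

abbreviation B5 :: "nat set" where "B5 \<equiv> {..<5}"

abbreviation B4 :: "nat set" where "B4 \<equiv> {5..<9}"

lemma Ball_B5: "(\<forall>i\<in>B5. P i) \<longleftrightarrow> P 0 \<and> P 1 \<and> P 2 \<and> P 3 \<and> P 4"
proof -
  have "B5 = {0, 1, 2, 3, 4}" by auto
  then show ?thesis by simp
qed

lemma Ball_B4: "(\<forall>i\<in>B4. P i) \<longleftrightarrow> P 5 \<and> P 6 \<and> P 7 \<and> P 8"
proof -
  have "B4 = {5, 6, 7, 8}" by auto
  then show ?thesis by simp
qed

lemma sign_B5: "sign a B5 = (if 0 \<in> a then -1 else 1) * (if 1 \<in> a then -1 else 1) *
  (if 2 \<in> a then -1 else 1) * (if 3 \<in> a then -1 else 1) * (if 4 \<in> a then -1 else 1)"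
proof -
  have "B5 = {0, 1, 2, 3, 4}" by auto
  then show ?thesis by (simp add: sign_def)
qed

lemma sign_B4: "sign a B4 = (if 5 \<in> a then -1 else 1) * (if 6 \<in> a then -1 else 1) *
  (if 7 \<in> a then -1 else 1) * (if 8 \<in> a then -1 else 1)"
proof -
  have "B4 = {5, 6, 7, 8}" by auto
  then show ?thesis by (simp add: sign_def)
qed

lemma card_le_2_subset:
  assumes "finite T" "card T \<le> 2" "T \<subseteq> B" "B \<noteq> {}"
  obtains p q where "p \<in> B" "q \<in> B" "T \<subseteq> {p, q}"
proof -
  consider "card T = 0" | "card T = 1" | "card T = 2" using assms(2) by linarith
  then show thesis
  proof cases
    case 1
    with assms that show thesis by auto
  next
    case 2
    with assms that show thesis by (auto simp: card_1_singleton_iff)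
  next
    case 3
    with assms that show thesis by (auto simp: card_2_iff)
  qed
qed

lemma card_le_1_subset:
  assumes "finite T" "card T \<le> 1" "T \<subseteq> B" "B \<noteq> {}"
  obtains p where "p \<in> B" "T \<subseteq> {p}"
proof (cases "card T = 0")
  case False
  with assms(2) have "card T = 1" by linarith
  with assms that show thesis by (auto simp: card_1_singleton_iff)
qed (use assms that in auto)

lemma nbrs_iff:
  "0 \<in> nbrs a \<longleftrightarrow> (4 \<in> a) \<noteq> (1 \<in> a)"
  "1 \<in> nbrs a \<longleftrightarrow> (0 \<in> a) \<noteq> (2 \<in> a)"
  "2 \<in> nbrs a \<longleftrightarrow> (1 \<in> a) \<noteq> (3 \<in> a)"
  "3 \<in> nbrs a \<longleftrightarrow> (2 \<in> a) \<noteq> (4 \<in> a)"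
  "4 \<in> nbrs a \<longleftrightarrow> (3 \<in> a) \<noteq> (0 \<in> a)"
  "5 \<in> nbrs a \<longleftrightarrow> (8 \<in> a) \<noteq> (6 \<in> a)"
  "6 \<in> nbrs a \<longleftrightarrow> (5 \<in> a) \<noteq> (7 \<in> a)"
  "7 \<in> nbrs a \<longleftrightarrow> (6 \<in> a) \<noteq> (8 \<in> a)"
  "8 \<in> nbrs a \<longleftrightarrow> (7 \<in> a) \<noteq> (5 \<in> a)"
  by (simp_all add: nbrs_def prv_def nxt_def numeral_eq_Suc)

text \<open>
  An operator on \<open>T\<close> is a combination of terms that shift by \<open>a \<subseteq> T\<close> in the computational
  basis; up to a shift inside \<open>T\<close>, such a term shifts the graph basis by \<open>nbrs a\<close>. On a block
  \<open>B\<close> the code space is spanned by the graph basis states \<open>{}\<close> and \<open>B\<close>.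
\<close>

lemma detect_B5:
  assumes "T \<inter> B5 \<subseteq> {p, q}" "p \<in> B5" "q \<in> B5" "a \<subseteq> T"
  shows "\<not> (\<forall>i\<in>B5. i \<notin> T \<longrightarrow> i \<in> nbrs a)"
    and "\<forall>i\<in>B5. i \<notin> T \<longrightarrow> i \<notin> nbrs a \<Longrightarrow> sign a B5 = 1"
proof -
  have T: "\<forall>i\<in>B5. i \<in> T \<longrightarrow> i = p \<or> i = q" using assms by auto
  have a: "\<forall>i\<in>B5. i \<in> a \<longrightarrow> i \<in> T" using assms by auto
  have pq: "p = 0 \<or> p = 1 \<or> p = 2 \<or> p = 3 \<or> p = 4" "q = 0 \<or> q = 1 \<or> q = 2 \<or> q = 3 \<or> q = 4"
    using assms by auto
  show "\<not> (\<forall>i\<in>B5. i \<notin> T \<longrightarrow> i \<in> nbrs a)"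
    using pq T a unfolding Ball_B5 nbrs_iff
    by (elim disjE) (simp; blast?)+
  \<comment> \<open>This sign is the ratio of the factors by which the error acts on the states
    \<open>B5\<close> and \<open>{}\<close>; the value 1 means that an undetected error acts as a
    scalar on the code space.\<close>
  show "sign a B5 = 1" if "\<forall>i\<in>B5. i \<notin> T \<longrightarrow> i \<notin> nbrs a"
    using pq T a that unfolding Ball_B5 nbrs_iff sign_B5
    by (elim disjE) (simp; blast?)+
qed

text \<open>The code on the 4-cycle has distance 2: the same two conditions hold for one error
  position instead of two.\<close>

lemma detect_B4:
  assumes "T \<inter> B4 \<subseteq> {p}" "p \<in> B4" "a \<subseteq> T"
  shows "\<not> (\<forall>i\<in>B4. i \<notin> T \<longrightarrow> i \<in> nbrs a)"
    and "\<forall>i\<in>B4. i \<notin> T \<longrightarrow> i \<notin> nbrs a \<Longrightarrow> sign a B4 = 1"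
proof -
  have T: "\<forall>i\<in>B4. i \<in> T \<longrightarrow> i = p" using assms by auto
  have a: "\<forall>i\<in>B4. i \<in> a \<longrightarrow> i \<in> T" using assms by auto
  have p: "p = 5 \<or> p = 6 \<or> p = 7 \<or> p = 8"
    using assms by auto
  show "\<not> (\<forall>i\<in>B4. i \<notin> T \<longrightarrow> i \<in> nbrs a)"
    using p T a unfolding Ball_B4 nbrs_iff
    by (elim disjE) (simp; blast?)+
  show "sign a B4 = 1" if "\<forall>i\<in>B4. i \<notin> T \<longrightarrow> i \<notin> nbrs a"
    using p T a that unfolding Ball_B4 nbrs_iff sign_B4
    by (elim disjE) (simp; blast?)+
qed

text \<open>
  The shifts of the graph basis of the 5-cycle caused by an error on one qubit, and the sign
  that tells whether this error is \<open>Z\<close>-like (or absent) or not. As the 5-qubit code is perfect,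
  these shifts represent each syndrome exactly once.
\<close>

definition single_error_shifts :: "nat set set" where
  "single_error_shifts = {e. \<exists>i\<in>B5. (\<forall>l\<in>B5. l \<in> e \<longrightarrow> l = i) \<or>
    (\<forall>l\<in>B5. l \<noteq> i \<longrightarrow> (l \<in> e \<longleftrightarrow> l \<in> nbrs {i}))}"

definition correction_sign :: "nat set \<Rightarrow> complex" where
  "correction_sign e = (if \<exists>i\<in>B5. \<forall>l\<in>B5. l \<in> e \<longrightarrow> l = i then 1 else -1)"

lemma Bex_B5: "(\<exists>i\<in>B5. P i) \<longleftrightarrow> P 0 \<or> P 1 \<or> P 2 \<or> P 3 \<or> P 4"
  using Ball_B5[of "\<lambda>i. \<not> P i"] by blast

text \<open>Of the 32 subsets of \<open>B5\<close>, 16 are shifts by no error or by X, Y or Z at one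
  vertex, and no two of these are complementary. Only five bits matter, so this is a propositional
  fact.\<close>

lemma single_error_shifts_compl: "sd e B5 \<in> single_error_shifts \<longleftrightarrow> e \<notin> single_error_shifts"
  unfolding single_error_shifts_def mem_Collect_eq Bex_B5 Ball_B5 nbrs_iff
  by simp argo

text \<open>A complementary shift would make \<open>sd e B5\<close> a single-error shift as well,
  against uniqueness of the representative. For the sign, \<open>a\<close> meets \<open>B5\<close>
  exactly if \<open>e\<close> has more than one element there, because a vertex has two
  neighbours.\<close>

lemma correct_B5:
  assumes "T \<inter> B5 \<subseteq> {p}" "p \<in> B5" "a \<subseteq> T" "e \<in> single_error_shifts"
  shows "\<not> (\<forall>i\<in>B5. i \<notin> T \<longrightarrow> (i \<in> nbrs a \<longleftrightarrow> i \<notin> e))"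
    and "\<forall>i\<in>B5. i \<notin> T \<longrightarrow> (i \<in> nbrs a \<longleftrightarrow> i \<in> e) \<Longrightarrow> sign a B5 = correction_sign e"
proof -
  have T: "\<forall>i\<in>B5. i \<in> T \<longrightarrow> i = p" using assms by auto
  have a: "\<forall>i\<in>B5. i \<in> a \<longrightarrow> i \<in> T" using assms by auto
  have p: "p = 0 \<or> p = 1 \<or> p = 2 \<or> p = 3 \<or> p = 4" using assms by auto
  show "\<not> (\<forall>i\<in>B5. i \<notin> T \<longrightarrow> (i \<in> nbrs a \<longleftrightarrow> i \<notin> e))"
  proof
    assume shift: "\<forall>i\<in>B5. i \<notin> T \<longrightarrow> (i \<in> nbrs a \<longleftrightarrow> i \<notin> e)"
    have local_nbrs: "l \<in> nbrs a \<longleftrightarrow> l \<in> nbrs (a \<inter> B5)" if "l \<in> B5" for l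
      using that by (auto simp: nbrs_def prv_def nxt_def)
    have "a \<inter> B5 = {} \<or> a \<inter> B5 = {p}" using T a by auto
    then have "sd e B5 \<in> single_error_shifts"
    proof
      assume "a \<inter> B5 = {}"
      with local_nbrs have "\<forall>l\<in>B5. l \<notin> nbrs a" by (simp add: nbrs_def)
      with shift T have "\<forall>l\<in>B5. l \<in> sd e B5 \<longrightarrow> l = p" by auto
      with assms(2) show ?thesis unfolding single_error_shifts_def by blast
    next
      assume "a \<inter> B5 = {p}"
      with local_nbrs shift T have "\<forall>l\<in>B5. l \<noteq> p \<longrightarrow> (l \<in> sd e B5 \<longleftrightarrow> l \<in> nbrs {p})" by auto
      with assms(2) show ?thesis unfolding single_error_shifts_def by blast
    qed
    with assms(4) show False by (simp add: single_error_shifts_compl)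
  qed
  show "sign a B5 = correction_sign e" if "\<forall>i\<in>B5. i \<notin> T \<longrightarrow> (i \<in> nbrs a \<longleftrightarrow> i \<in> e)"
    using p T a that
    unfolding correction_sign_def Bex_B5 Ball_B5 nbrs_iff sign_B5
    by (elim disjE) (simp; blast?)+
qed

section \<open>The protocol\<close>

text \<open>\<open>l\<close> is a basis state of the two encoded qubits, labelled 0 and 5; adding a
  block turns encoded 0 into encoded 1.\<close>

definition block :: "nat set \<Rightarrow> nat set" where
  "block l = (if 0 \<in> l then B5 else {}) \<union> (if 5 \<in> l then B4 else {})"

text \<open>
  \<open>e\<close> is the shift of the graph basis between Alice and Bob, known modulo \<open>B5\<close> and \<open>B4\<close>
  before the choice of the output pair: the second block is kept iff its syndrome is trivial
  and that of the first is not. Exactly one representative of each class is an outcome.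
\<close>

definition keep_second :: "nat set \<Rightarrow> bool" where
  "keep_second e \<longleftrightarrow> e \<inter> B4 \<in> {{}, B4} \<and> e \<inter> B5 \<notin> {{}, B5}"

definition kept :: "nat set \<Rightarrow> nat" where
  "kept e = (if keep_second e then 5 else 0)"

definition outcomes :: "nat set set" where
  "outcomes = {e \<in> Pow {..<9}. if keep_second e then e \<inter> B4 = {} else e \<in> single_error_shifts}"

definition outcome_sign :: "nat set \<Rightarrow> complex" where
  "outcome_sign e = (if keep_second e then 1 else correction_sign e)"

text \<open>Up to a factor 1/2 this sends the graph basis state \<open>sd u (block l)\<close> to
  \<open>l\<close>: it measures both syndromes and decodes.\<close>

definition alice_op :: "nat set \<Rightarrow> local_operator" where
  "alice_op u l x = (1 / complex_of_real (sqrt 2)) ^ 11 * row (sd u (block l)) x"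

text \<open>Bob decodes only the kept qubit, so \<open>e\<close> also fixes the value of the other
  one relative to \<open>u\<close>. The factor \<open>outcome_sign e\<close> is an encoded Z
  correction.\<close>

definition bob_op :: "nat set \<Rightarrow> nat set \<Rightarrow> local_operator" where
  "bob_op u e l x = (1 / complex_of_real (sqrt 2)) ^ 9 * (if l = {} then 1 else outcome_sign e) *
    row (sd u (sd e (block l))) x"

text \<open>The qubit that is not kept is measured in the computational basis with result
  \<open>m\<close> and removed.\<close>

definition discard_op :: "nat set \<Rightarrow> local_operator" where
  "discard_op m l x = (if x = l \<union> m then 1 else 0)"

text \<open>
  \<open>us\<close> enumerates all subsets of \<open>{..<9}\<close>, so that each of Alice's syndromes occurs for four \<open>u\<close>
  (hence \<open>11 = 9 + 2\<close> in \<open>alice_op\<close>), and \<open>es\<close> enumerates \<open>outcomes\<close>.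
\<close>

definition discard_step :: "nat \<Rightarrow> protocol" where
  "discard_step j = Operate Alice
    (map (\<lambda>m. ({j}, lift Alice (discard_op m), Output)) [{}, {5 - j}])"

definition bob_step :: "nat set list \<Rightarrow> nat set \<Rightarrow> protocol" where
  "bob_step es u = Operate Bob (map (\<lambda>e. ({kept e}, lift Bob (bob_op u e), discard_step (kept e))) es)"

definition purification :: "nat set list \<Rightarrow> nat set list \<Rightarrow> protocol" where
  "purification us es = Operate Alice (map (\<lambda>u. ({0, 5}, lift Alice (alice_op u), bob_step es u)) us)"

section \<open>Completeness of the measurements\<close>

lemma sd_simps [simp]: "sd a {} = a" "sd {} a = a" "sd a a = {}" "sd a (sd a b) = b" "sd (sd b a) a = b"
  by (auto simp: sd_def)

lemma sd_subset: "a \<subseteq> V \<Longrightarrow> b \<subseteq> V \<Longrightarrow> sd a b \<subseteq> V"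
  by (auto simp: sd_def)

lemma block_subset: "block l \<subseteq> {..<9}"
  by (auto simp: block_def)

lemma block_simps [simp]: "block {} = {}" "block {0} = B5" "block {5} = B4"
  by (auto simp: block_def)

lemma block_Un: "k \<inter> l = {} \<Longrightarrow> block (k \<union> l) = sd (block k) (block l)"
  by (rule set_eqI) (force simp: block_def)

text \<open>The offset between the graph states of Bob and Alice is free of \<open>u\<close>;
  \<open>sd b a\<close> is their mismatch on the kept qubit.\<close>

lemma sd_sd_cancel: "sd (sd u (sd e b)) (sd u (sd a m)) = sd e (sd (sd b a) m)"
  by (rule set_eqI) (simp, argo)

lemma inv_sqrt2_power_sq:
  "((1 / complex_of_real (sqrt 2)) ^ n) * cnj ((1 / complex_of_real (sqrt 2)) ^ n) = 1 / 2 ^ n"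
  by (simp add: power_mult_distrib[symmetric] power_one_over flip: of_real_mult)

lemma sum_Pow_sd:
  assumes "b \<subseteq> V"
  shows "(\<Sum>c\<in>Pow V. f (sd b c)) = (\<Sum>c\<in>Pow V. f c)"
  by (rule sum.reindex_bij_witness[where i = "sd b" and j = "sd b"])
    (use assms sd_subset in auto)

lemma outcome_sign_sq [simp]: "outcome_sign e * cnj (outcome_sign e) = 1" "outcome_sign e * outcome_sign e = 1"
  by (simp_all add: outcome_sign_def correction_sign_def)

text \<open>The involution \<open>\<tau>\<close> exchanges \<open>outcomes\<close> with its
  complement, so the code spaces of the outcomes exhaust the graph basis without overlap.\<close>

lemma sum_outcomes:
  "(\<Sum>e\<in>outcomes. f e + f (sd e (block {kept e}))) = (\<Sum>c\<in>Pow {..<9}. f c :: complex)"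
proof -
  define \<tau> where "\<tau> e = sd e (block {kept e})" for e
  have B: "B5 \<inter> B4 = {}" by auto
  have sub: "\<tau> e \<in> Pow {..<9}" if "e \<in> Pow {..<9}" for e
    using that block_subset sd_subset unfolding \<tau>_def by blast
  have int5: "sd e B5 \<inter> B5 = B5 - e" "sd e B5 \<inter> B4 = e \<inter> B4" for e by auto
  have int4: "sd e B4 \<inter> B4 = B4 - e" "sd e B4 \<inter> B5 = e \<inter> B5" for e by auto
  have triv: "A - e \<in> {{}, A} \<longleftrightarrow> e \<inter> A \<in> {{}, A}" for A e :: "nat set" by auto
  \<comment> \<open>Complementing inside a block does not change whether a syndrome is trivial, so a
    second application of \<open>\<tau>\<close> uses the same block.\<close>
  have ks: "keep_second (\<tau> e) \<longleftrightarrow> keep_second e" for e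
  proof (cases "keep_second e")
    case True
    then have "\<tau> e = sd e B4" by (simp add: \<tau>_def kept_def)
    then show ?thesis unfolding keep_second_def by (simp only: int4 triv)
  next
    case False
    then have "\<tau> e = sd e B5" by (simp add: \<tau>_def kept_def)
    then show ?thesis unfolding keep_second_def by (simp only: int5 triv)
  qed
  have invol: "\<tau> (\<tau> e) = e" for e
    using ks[of e] by (simp add: \<tau>_def kept_def)
  have out: "\<tau> e \<in> outcomes \<longleftrightarrow> e \<notin> outcomes" if "e \<in> Pow {..<9}" for e
  proof (cases "keep_second e")
    case True
    then have "e \<inter> B4 \<in> {{}, B4}" by (simp add: keep_second_def)
    then have "B4 - e = {} \<longleftrightarrow> e \<inter> B4 \<noteq> {}" by force
    with True that ks[of e] sub[OF that] show ?thesis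
      unfolding outcomes_def \<tau>_def kept_def by (simp add: int4)
  next
    case False
    with that ks[of e] sub[OF that] show ?thesis
      unfolding outcomes_def \<tau>_def kept_def by (simp add: single_error_shifts_compl)
  qed
  have osub: "outcomes \<subseteq> Pow {..<9}" by (auto simp: outcomes_def)
  have im: "\<tau> ` outcomes = Pow {..<9} - outcomes"
  proof
    show "\<tau> ` outcomes \<subseteq> Pow {..<9} - outcomes" using osub sub out by blast
    show "Pow {..<9} - outcomes \<subseteq> \<tau> ` outcomes"
      using out invol by (metis DiffE image_eqI subsetI)
  qed
  have inj: "inj_on \<tau> outcomes" by (rule inj_on_inverseI[of _ \<tau>]) (rule invol)
  have "(\<Sum>c\<in>Pow {..<9}. f c) = (\<Sum>c\<in>Pow {..<9} - outcomes. f c) + (\<Sum>c\<in>outcomes. f c)"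
    by (rule sum.subset_diff) (use osub in auto)
  also have "(\<Sum>c\<in>Pow {..<9} - outcomes. f c) = (\<Sum>e\<in>outcomes. f (\<tau> e))"
    unfolding im[symmetric] by (rule sum.reindex[OF inj, unfolded o_def])
  finally show ?thesis by (simp add: sum.distrib \<tau>_def add.commute)
qed

text \<open>For fixed \<open>l\<close> the shifted index runs through the whole graph basis and
  gives 512 / 2^11 = 1/4; there are four values of \<open>l\<close>.\<close>

lemma complete_alice:
  assumes us: "distinct us" "set us = Pow {..<9}"
  shows "complete_kraus {..<9} (map (\<lambda>u. ({0, 5}, alice_op u)) us)"
  unfolding complete_kraus_def
proof (intro ballI)
  fix x y :: "nat set" assume "x \<in> Pow {..<9}" "y \<in> Pow {..<9}"
  then have xy: "x \<subseteq> {..<9}" "y \<subseteq> {..<9}" by auto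
  have "(\<Sum>(M, k)\<leftarrow>map (\<lambda>u. ({0, 5}, alice_op u)) us. \<Sum>z\<in>Pow M. k z x * cnj (k z y))
      = (\<Sum>u\<in>Pow {..<9}. \<Sum>l\<in>Pow {0, 5}. alice_op u l x * cnj (alice_op u l y))"
    using us by (simp add: o_def sum_list_distinct_conv_sum_set)
  also have "\<dots> = (\<Sum>l\<in>Pow {0, 5}. \<Sum>u\<in>Pow {..<9}. alice_op u l x * cnj (alice_op u l y))"
    by (rule sum.swap)
  also have "\<dots> = (\<Sum>l\<in>Pow {0, 5 :: nat}. if x = y then 1 / 4 else 0)"
  proof (intro sum.cong refl)
    fix l :: "nat set"
    have "(\<Sum>u\<in>Pow {..<9}. alice_op u l x * cnj (alice_op u l y))
        = (\<Sum>u\<in>Pow {..<9}. 1 / 2 ^ 11 * (row (sd (block l) u) x * cnj (row (sd (block l) u) y)))"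
    proof (intro sum.cong refl)
      fix u
      have "alice_op u l x * cnj (alice_op u l y)
        = ((1 / complex_of_real (sqrt 2)) ^ 11 * cnj ((1 / complex_of_real (sqrt 2)) ^ 11)) *
          (row (sd u (block l)) x * cnj (row (sd u (block l)) y))"
        by (simp only: alice_op_def complex_cnj_mult mult_ac)
      also have "sd u (block l) = sd (block l) u" by auto
      finally show "alice_op u l x * cnj (alice_op u l y)
          = 1 / 2 ^ 11 * (row (sd (block l) u) x * cnj (row (sd (block l) u) y))"
        by (simp only: inv_sqrt2_power_sq)
    qed
    also have "\<dots> = 1 / 2 ^ 11 * (\<Sum>u\<in>Pow {..<9}. row u x * cnj (row u y))"
      unfolding sum_distrib_left[symmetric]
      by (subst sum_Pow_sd[OF block_subset, of "\<lambda>u. row u x * cnj (row u y)"]) (rule refl)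
    also have "\<dots> = (if x = y then 1 / 4 else 0)"
      by (simp add: sum_row_cnj_row xy)
    finally show "(\<Sum>u\<in>Pow {..<9}. alice_op u l x * cnj (alice_op u l y)) = (if x = y then 1 / 4 else 0)" .
  qed
  also have "\<dots> = (if x = y then 1 else 0)"
    by (simp add: card_Pow)
  finally show "(\<Sum>(M, k)\<leftarrow>map (\<lambda>u. ({0, 5}, alice_op u)) us. \<Sum>z\<in>Pow M. k z x * cnj (k z y))
      = (if x = y then 1 else 0)" .
qed

text \<open>The signs have modulus 1, so \<open>sum_outcomes\<close> leaves the sum over the whole
  graph basis, with total weight 512 / 2^9 = 1.\<close>

lemma complete_bob:
  assumes es: "distinct es" "set es = outcomes" and u: "u \<subseteq> {..<9}"
  shows "complete_kraus {..<9} (map (\<lambda>e. ({kept e}, bob_op u e)) es)"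
  unfolding complete_kraus_def
proof (intro ballI)
  fix x y :: "nat set" assume "x \<in> Pow {..<9}" "y \<in> Pow {..<9}"
  then have xy: "x \<subseteq> {..<9}" "y \<subseteq> {..<9}" by auto
  define g where "g c = 1 / 2 ^ 9 * (row (sd u c) x * cnj (row (sd u c) y))" for c
  have term_eq: "bob_op u e l x * cnj (bob_op u e l y) = g (sd e (block l))" for e l
  proof -
    let ?\<epsilon> = "if l = {} then 1 else outcome_sign e"
    have "bob_op u e l x * cnj (bob_op u e l y)
      = ((1 / complex_of_real (sqrt 2)) ^ 9 * cnj ((1 / complex_of_real (sqrt 2)) ^ 9)) * (?\<epsilon> * cnj ?\<epsilon>) *
        (row (sd u (sd e (block l))) x * cnj (row (sd u (sd e (block l))) y))"
      by (simp only: bob_op_def complex_cnj_mult mult_ac)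
    also have "?\<epsilon> * cnj ?\<epsilon> = 1" by simp
    finally show ?thesis by (simp only: inv_sqrt2_power_sq g_def mult_1_right)
  qed
  have "(\<Sum>(M, k)\<leftarrow>map (\<lambda>e. ({kept e}, bob_op u e)) es. \<Sum>z\<in>Pow M. k z x * cnj (k z y))
      = (\<Sum>e\<in>outcomes. \<Sum>l\<in>Pow {kept e}. g (sd e (block l)))"
    using es by (simp add: o_def sum_list_distinct_conv_sum_set term_eq)
  also have "\<dots> = (\<Sum>e\<in>outcomes. g e + g (sd e (block {kept e})))"
    by (intro sum.cong refl) (simp add: Pow_insert)
  also have "\<dots> = (\<Sum>c\<in>Pow {..<9}. g c)"
    by (rule sum_outcomes)
  also have "\<dots> = 1 / 2 ^ 9 * (\<Sum>c\<in>Pow {..<9}. row c x * cnj (row c y))"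
    unfolding g_def sum_distrib_left[symmetric]
    by (subst sum_Pow_sd[OF u, of "\<lambda>u. row u x * cnj (row u y)"]) (rule refl)
  also have "\<dots> = (if x = y then 1 else 0)"
    by (simp add: sum_row_cnj_row xy)
  finally show "(\<Sum>(M, k)\<leftarrow>map (\<lambda>e. ({kept e}, bob_op u e)) es. \<Sum>z\<in>Pow M. k z x * cnj (k z y))
      = (if x = y then 1 else 0)" .
qed

lemma complete_discard:
  assumes "j = 0 \<or> j = 5"
  shows "complete_kraus {0, 5} (map (\<lambda>m. ({j}, discard_op m)) [{}, {5 - j}])"
  using assms unfolding complete_kraus_def discard_op_def
  by (auto simp: Pow_insert insert_commute doubleton_eq_iff)

lemma kept_cases: "kept e = 0 \<or> kept e = 5"
  by (simp add: kept_def)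

lemma two_way_epp_purification:
  assumes us: "distinct us" "set us = Pow {..<9}" and es: "distinct es" "set es = outcomes"
  shows "two_way_epp 9 (purification us es)"
proof -
  have discard: "valid_protocol (discard_step j) R" if "j = 0 \<or> j = 5" "R Alice = {0, 5}" "R Bob = {j}" for j R
    using instrument_lift[OF _ complete_discard[OF that(1)], of Alice] that(2,3)
    by (simp add: discard_step_def held_def o_def)
  have bob: "valid_protocol (bob_step es u) R" if "u \<subseteq> {..<9}" "R Alice = {0, 5}" "R Bob = {..<9}" for u R
    using instrument_lift[OF _ complete_bob[OF es that(1)], of Bob] that
    by (auto simp: bob_step_def held_def o_def case_prod_unfold intro!: discard kept_cases)
  show ?thesis
    using instrument_lift[OF _ complete_alice[OF us], of Alice] us(2)
    by (auto simp: two_way_epp_def purification_def initial_registers_def held_def o_def case_prod_unfold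
        intro!: bob)
qed

section \<open>Correctness of the kept pair\<close>

lemma disjointD: "A \<inter> B = {} \<Longrightarrow> x \<in> B \<Longrightarrow> x \<notin> A"
  by blast

text \<open>The two cycles share no edge, so errors in one block do not shift the other.\<close>

lemma shift_B5_trivial:
  assumes "T \<inter> B5 = {}" "a \<subseteq> T"
  shows "i \<in> B5 \<Longrightarrow> i \<notin> nbrs a"
  using assms by (auto simp: nbrs_def nxt_def prv_def subset_iff disjoint_iff split: if_splits)

lemma shift_B4_trivial:
  assumes "T \<inter> B4 = {}" "a \<subseteq> T"
  shows "i \<in> B4 \<Longrightarrow> i \<notin> nbrs a"
  using assms by (auto simp: nbrs_def nxt_def prv_def subset_iff disjoint_iff split: if_splits)

lemma card_blocks:
  assumes "T \<subseteq> {..<9}"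
  shows "card (T \<inter> B5) + card (T \<inter> B4) = card T"
proof -
  have "card ((T \<inter> B5) \<union> (T \<inter> B4)) = card (T \<inter> B5) + card (T \<inter> B4)"
    by (rule card_Un_disjoint) auto
  moreover have "(T \<inter> B5) \<union> (T \<inter> B4) = T" using assms by auto
  ultimately show ?thesis by simp
qed

text \<open>\<open>a\<close> is the bit-flip part of the error, \<open>W\<close> the mismatch on the
  kept qubit, \<open>m\<close> the discarded value, and \<open>shift\<close> the condition for a
  nonzero amplitude. In each case of the protocol the kept labels agree and Bob has corrected the
  relative sign.\<close>

lemma good_outcome:
  assumes T: "T \<subseteq> {..<9}" "card T \<le> 2" and a: "a \<subseteq> T" and e: "e \<in> outcomes"
    and m: "m = {} \<or> m = {5 - kept e}" and W: "W = {} \<or> W = block {kept e}"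
    and shift: "sd (nbrs a) (sd e (sd W (block m))) \<inter> {..<9} \<subseteq> T"
  shows "W = {} \<and> sign a (block {kept e}) = outcome_sign e"
proof -
  have fin: "finite (T \<inter> B5)" "finite (T \<inter> B4)" by auto
  have card: "card (T \<inter> B5) + card (T \<inter> B4) \<le> 2" using card_blocks T by simp
  have "0 \<in> B5" "5 \<in> B4" by simp_all
  then have ne: "B5 \<noteq> {}" "B4 \<noteq> {}" by blast+
  have sh: "i \<in> nbrs a \<longleftrightarrow> i \<in> sd e (sd W (block m))" if "i < 9" "i \<notin> T" for i
    using shift that by auto
  show ?thesis
  proof (cases "keep_second e")
    case True
    then have k: "kept e = 5" and e4: "e \<inter> B4 = {}" and e5: "e \<inter> B5 \<noteq> {}" "e \<inter> B5 \<noteq> B5"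
      using e by (auto simp: kept_def outcomes_def keep_second_def)
    have m5: "block m = {} \<or> block m = B5" and W4: "W = {} \<or> W = B4" using m W k by auto
    \<comment> \<open>The nontrivial first syndrome forces an error in the first block, which leaves
      at most one for the second.\<close>
    have "T \<inter> B5 \<noteq> {}"
    proof
      assume T5: "T \<inter> B5 = {}"
      have "i \<notin> sd e (block m)" if "i \<in> B5" for i
        using sh[of i] shift_B5_trivial[OF T5 a that] W4 disjointD[OF T5 that] that by auto
      then have "e \<inter> B5 = {} \<or> e \<inter> B5 = B5" using m5 by auto
      with e5 show False by blast
    qed
    then have "card (T \<inter> B5) \<noteq> 0" by simp
    with card have "card (T \<inter> B4) \<le> 1" by linarith
    then obtain p where p: "p \<in> B4" "T \<inter> B4 \<subseteq> {p}"
      using card_le_1_subset[OF fin(2) _ Int_lower2 ne(2)] by blast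
    have sh4: "\<forall>i\<in>B4. i \<notin> T \<longrightarrow> (i \<in> nbrs a \<longleftrightarrow> i \<in> W)"
      using sh m5 e4 by force
    have "W = {}"
    proof (rule ccontr)
      assume "W \<noteq> {}"
      with W4 sh4 show False using detect_B4(1)[OF p(2,1) a] by blast
    qed
    with sh4 detect_B4(2)[OF p(2,1) a] k True show ?thesis
      by (simp add: outcome_sign_def)
  next
    case False
    then have k: "kept e = 0" and ses: "e \<in> single_error_shifts"
      using e by (auto simp: kept_def outcomes_def)
    have m4: "block m = {} \<or> block m = B4" and W5: "W = {} \<or> W = B5" using m W k by auto
    have sh5: "\<forall>i\<in>B5. i \<notin> T \<longrightarrow> (i \<in> nbrs a \<longleftrightarrow> (i \<in> e) \<noteq> (i \<in> W))"
      using sh m4 by force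
    show ?thesis
    proof (cases "e \<inter> B5 = {}")
      case e5: True
      have "card (T \<inter> B5) \<le> 2" using card by linarith
      then obtain p q where pq: "p \<in> B5" "q \<in> B5" "T \<inter> B5 \<subseteq> {p, q}"
        using card_le_2_subset[OF fin(1) _ Int_lower2 ne(1)] by blast
      have W0: "W = {}"
      proof (rule ccontr)
        assume "W \<noteq> {}"
        with W5 sh5 e5 show False using detect_B5(1)[OF pq(3,1,2) a] by blast
      qed
      have "\<exists>i\<in>B5. \<forall>l\<in>B5. l \<in> e \<longrightarrow> l = i" using e5 ne(1) by blast
      then have "correction_sign e = 1" by (simp add: correction_sign_def)
      moreover have "sign a B5 = 1" using detect_B5(2)[OF pq(3,1,2) a] sh5 W0 e5 by blast
      ultimately show ?thesis using W0 k False by (simp add: outcome_sign_def)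
    next
      case e5: False
      \<comment> \<open>The trivial class is represented by \<open>{}\<close>, hence not by its
        complement.\<close>
      have "e \<inter> B5 \<noteq> B5"
      proof
        assume "e \<inter> B5 = B5"
        then have "\<forall>l\<in>B5. l \<notin> sd e B5" by auto
        then have "sd e B5 \<in> single_error_shifts"
          unfolding single_error_shifts_def using ne(1) by blast
        with ses show False by (simp add: single_error_shifts_compl)
      qed
      with False e5 have e4: "e \<inter> B4 \<noteq> {}" "e \<inter> B4 \<noteq> B4" by (auto simp: keep_second_def)
      \<comment> \<open>Both syndromes are nontrivial: the second block uses up one error, so the
        first has at most one.\<close>
      have "T \<inter> B4 \<noteq> {}"
      proof
        assume T4: "T \<inter> B4 = {}"
        have "i \<notin> sd e (block m)" if "i \<in> B4" for i
          using sh[of i] shift_B4_trivial[OF T4 a that] W5 disjointD[OF T4 that] that by auto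
        then have "e \<inter> B4 = {} \<or> e \<inter> B4 = B4" using m4 by auto
        with e4 show False by blast
      qed
      then have "card (T \<inter> B4) \<noteq> 0" by simp
      with card have "card (T \<inter> B5) \<le> 1" by linarith
      then obtain p where p: "p \<in> B5" "T \<inter> B5 \<subseteq> {p}"
        using card_le_1_subset[OF fin(1) _ Int_lower2 ne(1)] by blast
      have W0: "W = {}"
      proof (rule ccontr)
        assume "W \<noteq> {}"
        with W5 sh5 show False using correct_B5(1)[OF p(2,1) a ses] by blast
      qed
      then show ?thesis
        using sh5 correct_B5(2)[OF p(2,1) a ses] k False by (simp add: outcome_sign_def)
    qed
  qed
qed

definition final_vec :: "nat set \<Rightarrow> nat set \<Rightarrow> nat set \<Rightarrow> vec \<Rightarrow> vec" where
  "final_vec u e m \<psi> = apply_local Alice {0, 5} (discard_op m)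
    (apply_local Bob {..<9} (bob_op u e) (apply_local Alice {..<9} (alice_op u) \<psi>))"

text \<open>The EPR vector ties Alice's string to Bob's string before the error, so the amplitude is
  the matrix element in \<open>sum_row_row\<close>. The exponent 29 is 11 from Alice, 9 from Bob and
  9 from the EPR vector.\<close>

lemma final_vec_unit_error:
  assumes T: "T \<subseteq> {..<9}" and z: "z \<subseteq> T" and x: "x \<subseteq> T" and s: "s Alice \<union> m \<subseteq> {0, 5}"
  shows "final_vec u e m (unit_error T z x (epr_vec {..<9})) s
    = (1 / complex_of_real (sqrt 2)) ^ 29 * (if s Bob = {} then 1 else outcome_sign e) *
      (if sd (nbrs (sd z x)) (sd (sd u (sd e (block (s Bob)))) (sd u (block (s Alice \<union> m)))) \<inter> {..<9} \<subseteq> T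
       then phase z * phase x * sign (sd u (sd e (block (s Bob)))) z * sign (sd u (block (s Alice \<union> m))) x *
         2 ^ card ({..<9} - T) else 0)"
proof -
  let ?h = "1 / complex_of_real (sqrt 2)"
  let ?\<epsilon> = "if s Bob = {} then 1 else outcome_sign e"
  let ?r = "sd u (sd e (block (s Bob)))" and ?c = "sd u (block (s Alice \<union> m))"
  \<comment> \<open>One string of Alice survives: \<open>y\<close> with its part in \<open>T\<close>
    replaced by \<open>x\<close>.\<close>
  have inner: "apply_local Alice {..<9} (alice_op u) (unit_error T z x (epr_vec {..<9})) (s(Alice := l, Bob := y))
      = (if y \<inter> T = z then alice_op u l (x \<union> (y - T)) * ?h ^ 9 else 0)" if "y \<in> Pow {..<9}" for l y
  proof -
    have "x \<union> (y - T) \<in> Pow {..<9}" using that x T by auto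
    moreover have "apply_local Alice {..<9} (alice_op u) (unit_error T z x (epr_vec {..<9})) (s(Alice := l, Bob := y))
      = (\<Sum>w\<in>Pow {..<9}. if w = x \<union> (y - T) then if y \<inter> T = z then alice_op u l w * ?h ^ 9 else 0 else 0)"
      unfolding apply_local_def by (intro sum.cong refl) (simp add: unit_error_def epr_vec_def)
    ultimately show ?thesis by (simp add: sum.delta)
  qed
  have "final_vec u e m (unit_error T z x (epr_vec {..<9})) s
      = (\<Sum>l\<in>Pow {0, 5}. if l = s Alice \<union> m then apply_local Bob {..<9} (bob_op u e)
          (apply_local Alice {..<9} (alice_op u) (unit_error T z x (epr_vec {..<9}))) (s(Alice := l)) else 0)"
    unfolding final_vec_def apply_local_def[of Alice "{0, 5}"]
    by (intro sum.cong refl) (simp add: discard_op_def)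
  also have "\<dots> = apply_local Bob {..<9} (bob_op u e)
      (apply_local Alice {..<9} (alice_op u) (unit_error T z x (epr_vec {..<9}))) (s(Alice := s Alice \<union> m))"
    using s by (subst sum.delta) auto
  also have "\<dots> = (\<Sum>y\<in>Pow {..<9}. ?h ^ 29 * ?\<epsilon> * (if y \<inter> T = z then row ?r y * row ?c (x \<union> (y - T)) else 0))"
  proof -
    have pow: "?h ^ 29 = ?h ^ 9 * ?h ^ 11 * ?h ^ 9" by (simp only: power_add[symmetric]) simp
    show ?thesis
      unfolding apply_local_def[of Bob]
    proof (intro sum.cong refl)
      fix y :: "nat set" assume y: "y \<in> Pow {..<9}"
      show "bob_op u e ((s(Alice := s Alice \<union> m)) Bob) y *
          apply_local Alice {..<9} (alice_op u) (unit_error T z x (epr_vec {..<9}))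
            (s(Alice := s Alice \<union> m, Bob := y))
        = ?h ^ 29 * ?\<epsilon> * (if y \<inter> T = z then row ?r y * row ?c (x \<union> (y - T)) else 0)"
        unfolding inner[OF y] pow bob_op_def alice_op_def
        by (cases "y \<inter> T = z") (simp_all only: if_True if_False mult_zero_left mult_zero_right fun_upd_other mult_ac
            party.distinct not_False_eq_True simp_thms fun_upd_apply)
    qed
  qed
  also have "\<dots> = ?h ^ 29 * ?\<epsilon> *
      (\<Sum>y\<in>Pow {..<9}. if y \<inter> T = z then row ?r y * row ?c (x \<union> (y - T)) else 0)"
    by (rule sum_distrib_left[symmetric])
  finally show ?thesis unfolding sum_row_row[OF T z x] .
qed

text \<open>By \<open>good_outcome\<close>, amplitudes with different labels vanish and the two with
  equal labels coincide. The factor \<open>sqrt 2\<close> cancels the value of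
  \<open>epr_vec {kept e}\<close> at equal labels.\<close>

lemma final_vec_epr:
  assumes T: "T \<subseteq> {..<9}" "card T \<le> 2" and z: "z \<subseteq> T" and x: "x \<subseteq> T" and e: "e \<in> outcomes"
    and m: "m = {} \<or> m = {5 - kept e}"
    and s: "s Alice \<subseteq> {kept e}" "s Bob \<subseteq> {kept e}"
  shows "final_vec u e m (unit_error T z x (epr_vec {..<9})) s
    = complex_of_real (sqrt 2) * final_vec u e m (unit_error T z x (epr_vec {..<9})) (\<lambda>_. {}) *
      epr_vec {kept e} s"
proof -
  let ?j = "kept e" and ?a = "sd z x"
  let ?F = "final_vec u e m (unit_error T z x (epr_vec {..<9}))"
  let ?W = "if s Alice = s Bob then {} else block {?j}"
  let ?w = "block {?j}"
  have j: "?j = 0 \<or> ?j = 5" by (rule kept_cases)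
  have a: "?a \<subseteq> T" using z x sd_subset by blast
  have fin: "finite z" "finite x" "finite ?a" "finite ?w"
    using T z x a block_subset finite_subset[of _ "{..<9::nat}"] by blast+
  have sA: "s Alice = {} \<or> s Alice = {?j}" and sB: "s Bob = {} \<or> s Bob = {?j}" using s by auto
  have sub: "s Alice \<union> m \<subseteq> {0, 5}" "{} \<union> m \<subseteq> {0, 5}" using sA m j by auto
  have "s Alice \<inter> m = {}" using sA m j by auto
  then have blk: "block (s Alice \<union> m) = sd (block (s Alice)) (block m)"
    by (rule block_Un)
  have W: "sd (block (s Bob)) (block (s Alice)) = ?W"
    using sA sB by (elim disjE) simp_all
  have shift: "sd (sd u (sd e (block (s Bob)))) (sd u (block (s Alice \<union> m))) = sd e (sd ?W (block m))"
    unfolding blk sd_sd_cancel W by (rule refl)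
  have shift0: "sd (sd u (sd e (block {}))) (sd u (block ({} \<union> m))) = sd e (sd {} (block m))"
    using sd_sd_cancel[of u e "{}" "{}" "block m"] by simp
  note F = final_vec_unit_error[where s = s and m = m and u = u and e = e, OF T(1) z x sub(1), unfolded shift]
  note F0 = final_vec_unit_error[where s = "\<lambda>_. {}" and m = m and u = u and e = e, OF T(1) z x sub(2), unfolded shift0]
  show ?thesis
  proof (cases "s Alice = s Bob")
    case False
    have "?F s = 0"
    proof (rule ccontr)
      assume "?F s \<noteq> 0"
      then have "sd (nbrs ?a) (sd e (sd ?W (block m))) \<inter> {..<9} \<subseteq> T"
        unfolding F by (auto split: if_splits)
      from good_outcome[OF T a e m _ this] False have "block {?j} = {}" by auto
      moreover have "?j \<in> block {?j}" using j by (auto simp: block_def)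
      ultimately show False by blast
    qed
    with False show ?thesis by (simp add: epr_vec_def)
  next
    case True
    have "?F s = ?F (\<lambda>_. {})"
    proof (cases "sd (nbrs ?a) (sd e (sd {} (block m))) \<inter> {..<9} \<subseteq> T \<and> s Bob \<noteq> {}")
      case bad: True
      then have sB': "s Bob = {?j}" "s Alice = {?j}" using sB True by auto
      have sg: "sign ?a ?w = outcome_sign e"
        using good_outcome[OF T a e m, of "{}"] bad by blast
      \<comment> \<open>The right side is the relative sign caused by the error; Bob's factor equals
        it, and its square is 1.\<close>
      then have "outcome_sign e = sign ?w z * sign ?w x"
        using fin by (simp add: sign_commute[of ?a] sign_sd_right)
      then have "outcome_sign e * (sign ?w z * sign ?w x) = 1"
        using outcome_sign_sq(2)[of e] by metis
      then show ?thesis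
        using bad sB' True unfolding F F0 blk by (simp add: sign_sd mult_ac)
    next
      case False
      with True show ?thesis unfolding F F0 by auto
    qed
    with True show ?thesis by (simp add: epr_vec_def)
  qed
qed

text \<open>A branch is a triple \<open>u\<close>, \<open>e\<close>, \<open>m\<close>. Its three
  operations turn every ket and bra of the noisy mixture into a multiple of the EPR vector, so
  \<open>mixture_epr\<close> applies.\<close>

lemma produces_good_pairs_purification:
  assumes es: "set es = outcomes"
  shows "produces_good_pairs (purification us es) 9 1 2"
  unfolding produces_good_pairs_def
proof (intro allI impI ballI, clarify)
  fix T S R \<sigma>
  assume T: "T \<subseteq> {..<9}" "card T \<le> 2"
    and br: "(R, \<sigma>) \<in> branches (purification us es) (initial_registers 9) (noisy_pairs 9 T S)"
    and tr: "trace (all_qubits R) \<sigma> \<noteq> 0"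
  let ?R0 = "initial_registers 9"
  let ?R1 = "?R0(Alice := {0, 5})"
  let ?\<rho>0 = "noisy_pairs 9 T S"
  define \<rho>1 where "\<rho>1 u = act (held Alice ?R0) ({Alice} \<times> {0, 5}) (held_by_other Alice ?R0)
    (lift Alice (alice_op u)) ?\<rho>0" for u
  define \<rho>2 where "\<rho>2 u e = act (held Bob ?R1) ({Bob} \<times> {kept e}) (held_by_other Bob ?R1)
    (lift Bob (bob_op u e)) (\<rho>1 u)" for u e
  define R2 where "R2 e = ?R1(Bob := {kept e})" for e
  obtain u where "(R, \<sigma>) \<in> branches (bob_step es u) ?R1 (\<rho>1 u)"
    using br unfolding purification_def branches.simps set_map by (auto simp only: \<rho>1_def)
  then obtain e where e: "e \<in> outcomes" and "(R, \<sigma>) \<in> branches (discard_step (kept e)) (R2 e) (\<rho>2 u e)"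
    using es unfolding bob_step_def branches.simps set_map by (auto simp only: \<rho>2_def R2_def)
  then obtain m where m: "m = {} \<or> m = {5 - kept e}"
    and R: "R = (R2 e)(Alice := {kept e})"
    and \<sigma>: "\<sigma> = act (held Alice (R2 e)) ({Alice} \<times> {kept e}) (held_by_other Alice (R2 e))
      (lift Alice (discard_op m)) (\<rho>2 u e)"
    unfolding discard_step_def branches.simps set_map list.set by auto
  let ?J = "Pow T \<times> Pow T \<times> Pow T \<times> Pow T"
  let ?c = "\<lambda>(z, w, x, y). S ({Bob} \<times> z) ({Bob} \<times> w) ({Bob} \<times> x) ({Bob} \<times> y)"
  let ?f = "\<lambda>(z, w, x, y). unit_error T z x (epr_vec {..<9})"
  let ?g = "\<lambda>(z, w, x, y). unit_error T w y (epr_vec {..<9})"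
  have "mixture ?J ?c ?f ?g ?R0 ?\<rho>0"
    by (rule mixture_noisy_pairs[OF T(1)])
  from mixture_act[OF this, of Alice "alice_op u" "{0, 5}"]
  have "mixture ?J ?c (\<lambda>j. apply_local Alice {..<9} (alice_op u) (?f j))
      (\<lambda>j. apply_local Alice {..<9} (alice_op u) (?g j)) ?R1 (\<rho>1 u)"
    by (simp add: \<rho>1_def initial_registers_def)
  from mixture_act[OF this, of Bob "bob_op u e" "{kept e}"]
  have "mixture ?J ?c (\<lambda>j. apply_local Bob {..<9} (bob_op u e) (apply_local Alice {..<9} (alice_op u) (?f j)))
      (\<lambda>j. apply_local Bob {..<9} (bob_op u e) (apply_local Alice {..<9} (alice_op u) (?g j)))
      (R2 e) (\<rho>2 u e)"
    by (simp add: \<rho>2_def R2_def initial_registers_def)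
  from mixture_act[OF this, of Alice "discard_op m" "{kept e}"]
  have mix: "mixture ?J ?c (\<lambda>j. final_vec u e m (?f j)) (\<lambda>j. final_vec u e m (?g j)) R \<sigma>"
    by (simp add: \<sigma> R R2_def final_vec_def)
  have RA: "R Alice = {kept e}" and RB: "R Bob = {kept e}" by (simp_all add: R R2_def)
  let ?\<alpha> = "\<lambda>z x. complex_of_real (sqrt 2) * final_vec u e m (unit_error T z x (epr_vec {..<9})) (\<lambda>_. {})"
  have vec: "final_vec u e m (unit_error T z x (epr_vec {..<9})) s = ?\<alpha> z x * epr_vec {kept e} s"
    if "z \<in> Pow T" "x \<in> Pow T" "s Alice \<subseteq> {kept e}" "s Bob \<subseteq> {kept e}" for z x s
    by (rule final_vec_epr[OF T _ _ e m]) (use that in auto)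
  have "\<sigma> X Y / trace (all_qubits R) \<sigma> = epr_pairs {kept e} X Y"
    if "X \<in> Pow (all_qubits R)" "Y \<in> Pow (all_qubits R)" for X Y
  proof (rule mixture_epr[OF mix RA RB _ _ _ tr that,
        where \<alpha> = "\<lambda>(z, w, x, y). ?\<alpha> z x" and \<beta> = "\<lambda>(z, w, x, y). ?\<alpha> w y"])
    fix j s assume js: "j \<in> ?J" "s Alice \<subseteq> {kept e}" "s Bob \<subseteq> {kept e}"
    obtain z w x y where j: "j = (z, w, x, y)" by (cases j)
    show "final_vec u e m (?f j) s = (\<lambda>(z, w, x, y). ?\<alpha> z x) j * epr_vec {kept e} s"
      unfolding j prod.case by (rule vec) (use js j in auto)
    show "final_vec u e m (?g j) s = (\<lambda>(z, w, x, y). ?\<alpha> w y) j * epr_vec {kept e} s"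
      unfolding j prod.case by (rule vec) (use js j in auto)
  qed simp
  then show "1 \<le> card (R Alice) \<and> (\<forall>X\<in>Pow (all_qubits R). \<forall>Y\<in>Pow (all_qubits R).
      \<sigma> X Y / trace (all_qubits R) \<sigma> = epr_pairs (R Alice) X Y)"
    by (simp add: RA)
qed

theorem mainTheorem3:
  "(\<exists>P. two_way_epp 9 P \<and> produces_good_pairs P 9 1 2) \<and> \<not> quantum_hamming_bound 9 1 2"
proof
  obtain us where us: "distinct us" "set us = Pow {..<9::nat}"
    using finite_distinct_list[of "Pow {..<9::nat}"] by auto
  have "finite outcomes" by (simp add: outcomes_def)
  then obtain es where es: "distinct es" "set es = outcomes"
    using finite_distinct_list by blast
  show "\<exists>P. two_way_epp 9 P \<and> produces_good_pairs P 9 1 2"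
    using two_way_epp_purification[OF us es] produces_good_pairs_purification[OF es(2)] by blast
  \<comment> \<open>The left side of the bound is 2 (1 + 27 + 324) = 704, which exceeds 2^9 =
    512.\<close>
  have "{0..2} = {0, 1, 2 :: nat}" by auto
  then show "\<not> quantum_hamming_bound 9 1 2"
    by (simp add: quantum_hamming_bound_def choose_two)
qed

end
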